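(* In the setting of the context, suppose that $\mathcal P$ is perfect. Then, for all $A\in L(Y)$, (b)$\Rightarrow$(c)$\Rightarrow$(d), where: (b) $A$ is Fredholm; (c) $A$ is invertible at infinity; (d) all limit operators of $A$ are invertible and their inverses are uniformly bounded.
   Context: $Y$ is a real or complex Banach space, $L(Y)$ the bounded linear operators on $Y$. $\mathcal P=(P_n)_{n=0}^\infty\subset L(Y)$ satisfies: (i) $\sup_n\|P_nx\|=\|x\|$ for all $x\in Y$; (ii) for every $m\in\mathbb N_0$ there is $N(m)\ge m$ with $P_nP_m=P_m=P_mP_n$ for all $n\ge N(m)$. $Q_n:=I-P_n$. $\mathcal P$ is called perfect if $P_n$ converges strongly to $I$ on $Y$ and the adjoints $P_n^*$ converge strongly to $I^*$ on $Y^*$. $K(Y,\mathcal P)$ is the set of $K\in L(Y)$ with $\|KQ_n\|\to0$ and $\|Q_nK\|\to0$ as $n\to\infty$. $A\in L(Y)$ is invertible at infinity if there are $B\in L(Y)$, $T_1,T_2\in K(Y,\mathcal P)$ with $AB=I+T_1$, $BA=I+T_2$. $\mathcal P$-convergence $A_n\stackrel{\mathcal P}{\to}A$ (for $A_n,A\in L(Y)$) means $\|(A_n-A)K\|\to0$ and $\|K(A_n-A)\|\to0$ for all $K\in K(Y,\mathcal P)$. For some $N\in\mathbb N$, $\mathcal V=\{V_k\}_{k\in\mathbb Z^N}$ is a group of linear isometries on $Y$ with $V_0=I$, $V_kV_m=V_{k+m}$, such that: for all $m,n\in\mathbb N$ there is $k_0$ with $P_mV_kP_n=0$ if $|k|>k_0$;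 and for all $m\in\mathbb N$, $k\in\mathbb Z^N$ there is $n_0$ with $P_mV_kQ_n=0=Q_nV_kP_m$ if $n>n_0$. If $h=(h(n))\subset\mathbb Z^N$ with $|h(n)|\to\infty$ and $V_{-h(n)}AV_{h(n)}\stackrel{\mathcal P}{\to}A_h$, then $A_h$ is called a limit operator of $A$. $A$ is Fredholm if $\dim\ker A<\infty$ and $\dim(Y/A(Y))<\infty$. "Invertible" means bijective. *)

theory Defs
  imports "HOL-Analysis.Analysis"
begin

text \<open>
  The instances of this class are, up to isometric isomorphism, exactly the fields of real
  and of complex numbers, so a theorem over it is a theorem about both kinds of scalars.
\<close>

class real_or_complex = real_normed_field +
  assumes real_or_complex:
    "(\<forall>z. \<exists>a. z = a *\<^sub>R 1) \<or>
     (\<exists>j. j * j = - 1 \<and> (\<forall>z. \<exists>a b. z = a *\<^sub>R 1 + b *\<^sub>R j) \<and>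
          (\<forall>a b. norm (a *\<^sub>R 1 + b *\<^sub>R j) = sqrt (a\<^sup>2 + b\<^sup>2)))"

instance real :: real_or_complex
  by standard auto

instance complex :: real_or_complex
proof
  have "z = Re z *\<^sub>R 1 + Im z *\<^sub>R \<i>" for z
    by (simp add: complex_eq_iff)
  moreover have "norm (a *\<^sub>R 1 + b *\<^sub>R \<i>) = sqrt (a\<^sup>2 + b\<^sup>2)" for a b
    by (simp add: cmod_def)
  ultimately show "(\<forall>z::complex. \<exists>a. z = a *\<^sub>R 1) \<or>
     (\<exists>j::complex. j * j = - 1 \<and> (\<forall>z. \<exists>a b. z = a *\<^sub>R 1 + b *\<^sub>R j) \<and>
          (\<forall>a b. norm (a *\<^sub>R 1 + b *\<^sub>R j) = sqrt (a\<^sup>2 + b\<^sup>2)))"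
    by (intro disjI2 exI[of _ \<i>] conjI allI) (simp, blast, blast)
qed

text \<open>
  The type class \<open>banach\<close> only provides the underlying real Banach space. The scalar
  multiplication \<open>smul\<close> carries the real or complex structure; for real scalars it is forced
  to be \<open>scaleR\<close>.
\<close>

locale banach_space_over = vector_space smul
  for smul :: "'k::real_or_complex \<Rightarrow> 'a::banach \<Rightarrow> 'a" +
  assumes smul_of_real: "smul (of_real r) x = r *\<^sub>R x"
    and norm_smul: "norm (smul c x) = norm c * norm x"

text \<open>
  The types of bounded operators below are those of bounded real-linear maps, so \<open>L(Y)\<close> and the
  dual space are the subsets of maps homogeneous with respect to \<open>smul\<close>.
\<close>

definition bounded_ops :: "('k \<Rightarrow> 'a \<Rightarrow> 'a) \<Rightarrow> ('a::real_normed_vector \<Rightarrow>\<^sub>L 'a) set" where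
  "bounded_ops smul = {A :: 'a \<Rightarrow>\<^sub>L 'a. \<forall>c x. A (smul c x) = smul c (A x)}"

definition dual_space ::
    "('k \<Rightarrow> 'a \<Rightarrow> 'a) \<Rightarrow> ('a::real_normed_vector \<Rightarrow>\<^sub>L 'k::real_normed_field) set" where
  "dual_space smul = {f :: 'a \<Rightarrow>\<^sub>L 'k. \<forall>c x. f (smul c x) = c * f x}"

definition dual_op ::
    "('a::real_normed_vector \<Rightarrow>\<^sub>L 'a) \<Rightarrow> ('a \<Rightarrow>\<^sub>L 'k::real_normed_field) \<Rightarrow> ('a \<Rightarrow>\<^sub>L 'k)" where
  "dual_op A f = f o\<^sub>L A"

definition co_proj ::
    "(nat \<Rightarrow> 'a::real_normed_vector \<Rightarrow>\<^sub>L 'a) \<Rightarrow> nat \<Rightarrow> 'a \<Rightarrow>\<^sub>L 'a" where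
  "co_proj P n = id_blinfun - P n"

text \<open>\<open>Sup\<close> on the reals is unspecified for unbounded sets, hence the clause \<open>P_bdd\<close>.\<close>

locale approx_projections = banach_space_over smul
  for smul :: "'k::real_or_complex \<Rightarrow> 'a::banach \<Rightarrow> 'a" +
  fixes P :: "nat \<Rightarrow> 'a \<Rightarrow>\<^sub>L 'a"
  assumes P_op: "P n \<in> bounded_ops smul"
    and P_bdd: "bdd_above (range (\<lambda>n. norm (P n x)))"
    and P_sup: "(SUP n. norm (P n x)) = norm x"
    and P_absorb: "\<exists>N\<ge>m. \<forall>n\<ge>N. P n o\<^sub>L P m = P m \<and> P m o\<^sub>L P n = P m"

definition perfect ::
    "('k::real_normed_field \<Rightarrow> 'a::real_normed_vector \<Rightarrow> 'a) \<Rightarrow> (nat \<Rightarrow> 'a \<Rightarrow>\<^sub>L 'a) \<Rightarrow> bool" where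
  "perfect smul P \<longleftrightarrow>
     (\<forall>x. (\<lambda>n. P n x) \<longlonglongrightarrow> x) \<and>
     (\<forall>f \<in> dual_space smul. (\<lambda>n. dual_op (P n) f) \<longlonglongrightarrow> f)"

text \<open>\<open>K(Y,P)\<close>\<close>

definition P_compact_ops ::
    "('k \<Rightarrow> 'a::real_normed_vector \<Rightarrow> 'a) \<Rightarrow> (nat \<Rightarrow> 'a \<Rightarrow>\<^sub>L 'a) \<Rightarrow> ('a \<Rightarrow>\<^sub>L 'a) set" where
  "P_compact_ops smul P =
     {K \<in> bounded_ops smul.
        (\<lambda>n. norm (K o\<^sub>L co_proj P n)) \<longlonglongrightarrow> 0 \<and> (\<lambda>n. norm (co_proj P n o\<^sub>L K)) \<longlonglongrightarrow> 0}"

definition invertible_at_infinity ::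
    "('k \<Rightarrow> 'a::real_normed_vector \<Rightarrow> 'a) \<Rightarrow> (nat \<Rightarrow> 'a \<Rightarrow>\<^sub>L 'a) \<Rightarrow> ('a \<Rightarrow>\<^sub>L 'a) \<Rightarrow> bool" where
  "invertible_at_infinity smul P A \<longleftrightarrow>
     (\<exists>B \<in> bounded_ops smul. \<exists>T1 \<in> P_compact_ops smul P. \<exists>T2 \<in> P_compact_ops smul P.
        A o\<^sub>L B = id_blinfun + T1 \<and> B o\<^sub>L A = id_blinfun + T2)"

definition P_converges ::
    "('k \<Rightarrow> 'a::real_normed_vector \<Rightarrow> 'a) \<Rightarrow> (nat \<Rightarrow> 'a \<Rightarrow>\<^sub>L 'a) \<Rightarrow>
     (nat \<Rightarrow> 'a \<Rightarrow>\<^sub>L 'a) \<Rightarrow> ('a \<Rightarrow>\<^sub>L 'a) \<Rightarrow> bool" where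
  "P_converges smul P S A \<longleftrightarrow>
     (\<forall>K \<in> P_compact_ops smul P.
        (\<lambda>n. norm ((S n - A) o\<^sub>L K)) \<longlonglongrightarrow> 0 \<and> (\<lambda>n. norm (K o\<^sub>L (S n - A))) \<longlonglongrightarrow> 0)"

definition max_norm :: "int ^ 'N::finite \<Rightarrow> int" where
  "max_norm k = Max (range (\<lambda>i. \<bar>k $ i\<bar>))"

locale shift_setting = approx_projections smul P
  for smul :: "'k::real_or_complex \<Rightarrow> 'a::banach \<Rightarrow> 'a"
    and P :: "nat \<Rightarrow> 'a \<Rightarrow>\<^sub>L 'a" +
  fixes V :: "int ^ 'N::finite \<Rightarrow> 'a \<Rightarrow>\<^sub>L 'a"
  assumes V_op: "V k \<in> bounded_ops smul"
    and V_isometry: "norm (V k x) = norm x"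
    and V_zero: "V 0 = id_blinfun"
    and V_add: "V k o\<^sub>L V l = V (k + l)"
    and P_V_P: "\<lbrakk>m \<ge> 1; n \<ge> 1\<rbrakk> \<Longrightarrow> \<exists>k0. \<forall>k. max_norm k > k0 \<longrightarrow> P m o\<^sub>L V k o\<^sub>L P n = 0"
    and P_V_Q: "m \<ge> 1 \<Longrightarrow> \<exists>n0. \<forall>n>n0. P m o\<^sub>L V k o\<^sub>L co_proj P n = 0 \<and>
                                        co_proj P n o\<^sub>L V k o\<^sub>L P m = 0"

definition limit_ops ::
    "('k \<Rightarrow> 'a::real_normed_vector \<Rightarrow> 'a) \<Rightarrow> (nat \<Rightarrow> 'a \<Rightarrow>\<^sub>L 'a) \<Rightarrow>
     (int ^ 'N::finite \<Rightarrow> 'a \<Rightarrow>\<^sub>L 'a) \<Rightarrow> ('a \<Rightarrow>\<^sub>L 'a) \<Rightarrow> ('a \<Rightarrow>\<^sub>L 'a) set" where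
  "limit_ops smul P V A =
     {B \<in> bounded_ops smul. \<exists>h :: nat \<Rightarrow> int ^ 'N.
        filterlim (\<lambda>n. max_norm (h n)) at_top sequentially \<and>
        P_converges smul P (\<lambda>n. V (- h n) o\<^sub>L A o\<^sub>L V (h n)) B}"

definition finite_dimensional :: "('k::field \<Rightarrow> 'a::ab_group_add \<Rightarrow> 'a) \<Rightarrow> 'a set \<Rightarrow> bool" where
  "finite_dimensional smul S \<longleftrightarrow> (\<exists>F. finite F \<and> S = module.span smul F)"

text \<open>
  The whole quotient space is the image, under the quotient map \<open>x \<mapsto> x + S\<close>, of the span of
  finitely many vectors; that image is the span of the finitely many cosets of these vectors.
\<close>

definition finite_dimensional_quotient ::
    "('k::field \<Rightarrow> 'a::ab_group_add \<Rightarrow> 'a) \<Rightarrow> 'a set \<Rightarrow> bool" where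
  "finite_dimensional_quotient smul S \<longleftrightarrow>
     (\<exists>F. finite F \<and> range (\<lambda>x. (+) x ` S) = (\<lambda>x. (+) x ` S) ` module.span smul F)"

definition fredholm ::
    "('k::field \<Rightarrow> 'a::real_normed_vector \<Rightarrow> 'a) \<Rightarrow> ('a \<Rightarrow>\<^sub>L 'a) \<Rightarrow> bool" where
  "fredholm smul A \<longleftrightarrow>
     finite_dimensional smul {x. A x = 0} \<and> finite_dimensional_quotient smul (range A)"

text \<open>Bijectivity already makes \<open>inv B\<close> linear; boundedness ensures that \<open>onorm\<close> is its norm.\<close>

definition uniformly_invertible :: "('a::real_normed_vector \<Rightarrow>\<^sub>L 'a) set \<Rightarrow> bool" where
  "uniformly_invertible \<B> \<longleftrightarrow>
     (\<forall>B\<in>\<B>. bij (blinfun_apply B)) \<and>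
     (\<exists>C. \<forall>B\<in>\<B>. bounded_linear (inv (blinfun_apply B)) \<and> onorm (inv (blinfun_apply B)) \<le> C)"

end

theory Submission
  imports Defs
begin

text \<open>
  Fredholmness implies invertibility at infinity. A Fredholm operator \<open>A\<close> has a bounded
  regularizer \<open>B\<close>, for which \<open>A B - I\<close> and \<open>B A - I\<close> have finite rank
  (\<open>fredholm_regularizer\<close>). Two classical theorems enter: the Hahn-Banach theorem provides a
  bounded projection onto the kernel, and the open mapping theorem makes \<open>B\<close> bounded. If \<open>P\<close> is
  perfect then finite-rank operators belong to \<open>K(Y,P)\<close>, since \<open>Q\<^sub>n\<close> tends to zero strongly and
  so do the adjoints (\<open>finite_rank_in_P_compact_ops\<close>).

  Invertibility at infinity passes to limit operators. Let \<open>A B = I + T\<^sub>1\<close> and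
  \<open>B A = I + T\<^sub>2\<close> with \<open>T\<^sub>1\<close> and \<open>T\<^sub>2\<close> in \<open>K(Y,P)\<close>. Conjugation by the shifts \<open>V (h n)\<close>
  preserves the norm of \<open>B\<close> and moves \<open>T\<^sub>1\<close> and \<open>T\<^sub>2\<close> out of sight of every fixed \<open>P\<^sub>m\<close>
  (\<open>P_compact_shift_tendsto_0\<close>), while the conjugates of \<open>A\<close> approach the limit operator \<open>L\<close> next
  to \<open>P\<^sub>m\<close>. This gives \<open>\<parallel>P\<^sub>m x\<parallel> \<le> \<parallel>B\<parallel> \<parallel>L P\<^sub>m x\<parallel>\<close> and dually
  \<open>\<parallel>f P\<^sub>m\<parallel> \<le> \<parallel>B\<parallel> \<parallel>f P\<^sub>m L\<parallel>\<close> for functionals \<open>f\<close>. By perfectness \<open>P\<^sub>m\<close> can be removed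
  (\<open>limit_op_bounds\<close>). The first estimate shows that \<open>L\<close> is injective with closed range, the
  second, with Hahn-Banach, that the range is everything; and \<open>\<parallel>B\<parallel>\<close> bounds the inverses of all
  limit operators at once.
\<close>

section \<open>The Hahn-Banach theorem through minimal sublinear functionals\<close>

definition sublinear :: "('a::real_vector \<Rightarrow> real) \<Rightarrow> bool" where
  "sublinear p \<longleftrightarrow> (\<forall>x y. p (x + y) \<le> p x + p y) \<and> (\<forall>c>0. \<forall>x. p (c *\<^sub>R x) \<le> c * p x)"

lemma sublinear_add: "sublinear p \<Longrightarrow> p (x + y) \<le> p x + p y"
  by (simp add: sublinear_def)

text \<open>Applying the inequality of the definition with \<open>1/c\<close> as well turns it into an equation.\<close>

lemma sublinear_scale:
  assumes "sublinear p" "c > 0"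
  shows "p (c *\<^sub>R x) = c * p x"
proof (rule antisym)
  show "p (c *\<^sub>R x) \<le> c * p x"
    using assms by (simp add: sublinear_def)
  have "p ((1 / c) *\<^sub>R (c *\<^sub>R x)) \<le> (1 / c) * p (c *\<^sub>R x)"
    using assms unfolding sublinear_def by (metis zero_less_divide_1_iff)
  then show "c * p x \<le> p (c *\<^sub>R x)"
    using assms by (simp add: field_simps)
qed

lemma sublinear_zero: "sublinear p \<Longrightarrow> p 0 = 0"
  using sublinear_scale[of p 2 0] by simp

lemma sublinear_minus: "sublinear p \<Longrightarrow> - p (- x) \<le> p x"
  using sublinear_add[of p x "- x"] sublinear_zero[of p] by simp

text \<open>
  Subtracting from \<open>p\<close> its growth in the direction \<open>y\<close> yields a sublinear functional below
  \<open>p\<close> with \<open>q (- y) \<le> - p y\<close>: along the line through \<open>y\<close> it is as linear as possible. This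
  one construction shows that minimal functionals are linear, and it also makes the linear
  functional touch \<open>p\<close> at a prescribed vector.
\<close>

lemma sublinear_flatten:
  assumes p: "sublinear p"
  obtains q where "sublinear q" "\<And>x. q x \<le> p x" "\<And>x. q x \<le> p (x + y) - p y"
proof -
  define r where "r x t = p (x + t *\<^sub>R y) - t * p y" for x t
  define q where "q x = (INF t\<in>{0<..}. r x t)" for x
  have bdd: "bdd_below (r x ` {0<..})" for x
  proof (rule bdd_belowI2)
    fix t :: real assume "t \<in> {0<..}"
    then have "t * p y = p ((x + t *\<^sub>R y) + (- x))"
      using sublinear_scale[OF p] by simp
    then show "- p (- x) \<le> r x t"
      using sublinear_add[OF p, of "x + t *\<^sub>R y" "- x"] by (simp add: r_def)
  qed
  have q_le: "q x \<le> r x t" if "t > 0" for x t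
    unfolding q_def using that by (intro cINF_lower bdd) auto
  have q_ge: "m \<le> q x" if "\<And>t. t > 0 \<Longrightarrow> m \<le> r x t" for m x
    unfolding q_def using that by (intro cINF_greatest) auto
  have "q (x + z) \<le> q x + q z" for x z
  proof -
    have rr: "q (x + z) \<le> r x s + r z t" if "s > 0" "t > 0" for s t
    proof -
      have "q (x + z) \<le> r (x + z) (s + t)"
        using that by (intro q_le) simp
      also have "\<dots> \<le> r x s + r z t"
        using sublinear_add[OF p, of "x + s *\<^sub>R y" "z + t *\<^sub>R y"]
        by (simp add: r_def algebra_simps)
      finally show ?thesis .
    qed
    have "q (x + z) - r x s \<le> q z" if "s > 0" for s
      using rr that by (intro q_ge) (simp add: algebra_simps)
    then have "q (x + z) - q z \<le> q x"
      by (intro q_ge) (simp add: algebra_simps)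
    then show ?thesis by simp
  qed
  moreover have "q (c *\<^sub>R x) \<le> c * q x" if "c > 0" for c x
  proof -
    have "q (c *\<^sub>R x) / c \<le> q x"
    proof (rule q_ge)
      fix t :: real assume "t > 0"
      then have "q (c *\<^sub>R x) \<le> r (c *\<^sub>R x) (c * t)"
        using that by (intro q_le) simp
      also have "\<dots> = c * r x t"
        using sublinear_scale[OF p \<open>c > 0\<close>, of "x + t *\<^sub>R y"]
        by (simp add: r_def algebra_simps)
      finally show "q (c *\<^sub>R x) / c \<le> r x t"
        using that by (simp add: field_simps)
    qed
    then show ?thesis using that by (simp add: field_simps)
  qed
  ultimately have "sublinear q"
    by (simp add: sublinear_def)
  moreover have "q x \<le> p x" for x
  proof -
    have "q x \<le> r x 1" by (rule q_le) simp
    also have "\<dots> \<le> p x"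
      using sublinear_add[OF p, of x y] by (simp add: r_def)
    finally show ?thesis .
  qed
  moreover have "q x \<le> p (x + y) - p y" for x
    using q_le[of 1 x] by (simp add: r_def)
  ultimately show thesis by (rule that)
qed

text \<open>
  By minimality flattening leaves \<open>p\<close> unchanged, so its inequality \<open>q x \<le> p (x + y) - p y\<close>
  becomes superadditivity of \<open>p\<close>.
\<close>

lemma minimal_sublinear_imp_linear:
  assumes p: "sublinear p"
    and min: "\<And>q. sublinear q \<Longrightarrow> (\<And>x. q x \<le> p x) \<Longrightarrow> q = p"
  shows "linear p"
proof -
  have add: "p (x + y) = p x + p y" for x y
  proof (rule antisym[OF sublinear_add[OF p]])
    from sublinear_flatten[OF p] obtain q where
      "sublinear q" "\<And>x. q x \<le> p x" and q: "\<And>x. q x \<le> p (x + y) - p y" by blast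
    then have "q = p" by (intro min)
    then show "p x + p y \<le> p (x + y)" using q[of x] by simp
  qed
  have minus: "p (- x) = - p x" for x
    using add[of x "- x"] sublinear_zero[OF p] by simp
  have "p (c *\<^sub>R x) = c * p x" for c x
  proof (cases c "0 :: real" rule: linorder_cases)
    case less
    then have "p ((- c) *\<^sub>R x) = (- c) * p x"
      by (intro sublinear_scale[OF p]) simp
    then show ?thesis using minus[of "c *\<^sub>R x"] by simp
  qed (simp_all add: sublinear_zero[OF p] sublinear_scale[OF p])
  with add show ?thesis by (intro linearI) auto
qed

text \<open>
  Zorn's lemma applies because the infimum of a chain is finite: every sublinear functional
  below \<open>p\<close> satisfies \<open>- p (- x) \<le> q x\<close>. The chain property gives its subadditivity.
\<close>

lemma minimal_sublinear_exists:
  fixes p :: "'a::real_vector \<Rightarrow> real"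
  assumes p: "sublinear p"
  obtains f where "sublinear f" "\<And>x. f x \<le> p x"
    "\<And>q. sublinear q \<Longrightarrow> (\<And>x. q x \<le> f x) \<Longrightarrow> q = f"
proof -
  define S where "S = {q. sublinear q \<and> q \<le> p}"
  have pS: "p \<in> S" using p by (simp add: S_def)
  have "\<exists>f\<in>S. \<forall>q\<in>S. q \<le> f \<longrightarrow> q = f"
  proof (rule predicate_Zorn)
    show "partial_order_on S (relation_of (\<lambda>f q. q \<le> f) S)"
      by (rule partial_order_on_relation_ofI) auto
  next
    fix C assume "C \<in> Chains (relation_of (\<lambda>f q. q \<le> f) S)"
    then have CS: "C \<subseteq> S" and chain: "\<And>a b. a \<in> C \<Longrightarrow> b \<in> C \<Longrightarrow> a \<le> b \<or> b \<le> a"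
      by (auto simp: Chains_def relation_of_def)
    show "\<exists>u\<in>S. \<forall>a\<in>C. u \<le> a"
    proof (cases "C = {}")
      case True
      then show ?thesis using pS by auto
    next
      case False
      define u where "u x = (INF q\<in>C. q x)" for x
      have sub: "sublinear q" and le_p: "q x \<le> p x" if "q \<in> C" for q x
        using that CS by (auto simp: S_def le_fun_def)
      have bdd: "bdd_below ((\<lambda>q. q x) ` C)" for x
      proof (rule bdd_belowI2)
        fix q assume "q \<in> C"
        then show "- p (- x) \<le> q x"
          using sublinear_minus[OF sub, of q x] le_p[of q "- x"] by linarith
      qed
      have u_le: "u x \<le> q x" if "q \<in> C" for q x
        unfolding u_def using that by (intro cINF_lower bdd)
      have u_ge: "m \<le> u x" if "\<And>q. q \<in> C \<Longrightarrow> m \<le> q x" for m x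
        unfolding u_def using that False by (intro cINF_greatest)
      have "u (x + y) \<le> u x + u y" for x y
      proof -
        have qq: "u (x + y) \<le> a x + b y" if ab: "a \<in> C" "b \<in> C" for a b
        proof -
          obtain q where q: "q \<in> C" "q \<le> a" "q \<le> b"
            using chain[OF ab] ab by blast
          then have "u (x + y) \<le> q x + q y"
            using u_le[of q "x + y"] sublinear_add[OF sub[OF q(1)], of x y] by linarith
          also have "\<dots> \<le> a x + b y"
            using q by (intro add_mono) (auto simp: le_fun_def)
          finally show ?thesis .
        qed
        have "u (x + y) - a x \<le> u y" if a: "a \<in> C" for a
        proof (rule u_ge)
          fix b assume "b \<in> C"
          then show "u (x + y) - a x \<le> b y" using qq[OF a, of b] by simp
        qed
        then have "u (x + y) - u y \<le> u x"
          by (intro u_ge) (simp add: algebra_simps)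
        then show ?thesis by simp
      qed
      moreover have "u (c *\<^sub>R x) \<le> c * u x" if "c > 0" for c x
      proof -
        have "u (c *\<^sub>R x) / c \<le> u x"
        proof (rule u_ge)
          fix q assume q: "q \<in> C"
          have "u (c *\<^sub>R x) \<le> c * q x"
            using u_le[OF q, of "c *\<^sub>R x"] sublinear_scale[OF sub[OF q] that, of x] by simp
          then show "u (c *\<^sub>R x) / c \<le> q x"
            using that by (simp add: field_simps)
        qed
        then show ?thesis using that by (simp add: field_simps)
      qed
      moreover have "u \<le> p"
        using False u_le le_p by (fastforce simp: le_fun_def intro: order_trans)
      ultimately have "u \<in> S"
        by (simp add: S_def sublinear_def)
      then show ?thesis using u_le by (auto simp: le_fun_def)
    qed
  qed
  then obtain f where f: "f \<in> S" and min: "\<And>q. q \<in> S \<Longrightarrow> q \<le> f \<Longrightarrow> q = f" by blast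
  show thesis
  proof (rule that)
    show "sublinear f" "\<And>x. f x \<le> p x" using f by (auto simp: S_def le_fun_def)
    fix q assume "sublinear q" "\<And>x. q x \<le> f x"
    with f show "q = f" by (intro min) (auto simp: S_def le_fun_def intro: order_trans)
  qed
qed

text \<open>
  Flattening \<open>p\<close> along \<open>w\<close> first forces every linear functional below the result to satisfy
  \<open>f (- w) \<le> - p w\<close>, so that the minimal one touches \<open>p\<close> at \<open>w\<close>.
\<close>

theorem hahn_banach_sublinear:
  fixes p :: "'a::real_vector \<Rightarrow> real"
  assumes "sublinear p"
  obtains f where "linear f" "\<And>x. f x \<le> p x" "f w = p w"
proof -
  obtain q where q: "sublinear q" "\<And>x. q x \<le> p x" "\<And>x. q x \<le> p (x + w) - p w"
    using sublinear_flatten[OF assms] by blast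
  obtain f where f: "sublinear f" "\<And>x. f x \<le> q x"
      "\<And>g. sublinear g \<Longrightarrow> (\<And>x. g x \<le> f x) \<Longrightarrow> g = f"
    using minimal_sublinear_exists[OF q(1)] by blast
  have lin: "linear f"
    using f(1,3) by (rule minimal_sublinear_imp_linear)
  have le: "f x \<le> p x" for x
    using f(2) q(2) by (rule order_trans)
  have "f (- w) \<le> - p w"
    using f(2)[of "- w"] q(3)[of "- w"] sublinear_zero[OF assms] by simp
  then have "p w \<le> f w"
    using lin by (simp add: linear_neg)
  with le[of w] have "f w = p w" by simp
  with lin le show thesis by (intro that)
qed

text \<open>
  This is the majorant for the separation of a point from a closed subspace: a linear
  functional below it is nonpositive on \<open>S\<close>, hence zero there, and bounded by the norm.
\<close>

lemma sublinear_infdist_subspace: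
  fixes S :: "'a::real_normed_vector set"
  assumes S: "subspace S"
  shows "sublinear (\<lambda>x. infdist x S)"
proof -
  have ne: "S \<noteq> {}" using subspace_0[OF S] by auto
  have ge: "m \<le> infdist x S" if "\<And>s. s \<in> S \<Longrightarrow> m \<le> dist x s" for m x
    unfolding infdist_notempty[OF ne] using that ne by (intro cINF_greatest)
  have "infdist (x + y) S \<le> infdist x S + infdist y S" for x y
  proof -
    have st: "infdist (x + y) S \<le> dist x s + dist y t" if "s \<in> S" "t \<in> S" for s t
    proof -
      have "infdist (x + y) S \<le> dist (x + y) (s + t)"
        using that subspace_add[OF S] by (intro infdist_le)
      also have "\<dots> \<le> dist x s + dist y t" by (rule dist_triangle_add)
      finally show ?thesis .
    qed
    have "infdist (x + y) S - dist x s \<le> infdist y S" if "s \<in> S" for s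
      using st that by (intro ge) (simp add: algebra_simps)
    then have "infdist (x + y) S - infdist y S \<le> infdist x S"
      by (intro ge) (simp add: algebra_simps)
    then show ?thesis by simp
  qed
  moreover have "infdist (c *\<^sub>R x) S \<le> c * infdist x S" if "c > 0" for c x
  proof -
    have "infdist (c *\<^sub>R x) S / c \<le> infdist x S"
    proof (rule ge)
      fix s assume "s \<in> S"
      then have "infdist (c *\<^sub>R x) S \<le> dist (c *\<^sub>R x) (c *\<^sub>R s)"
        using subspace_scale[OF S] by (intro infdist_le)
      also have "\<dots> = c * dist x s"
        using that by (simp add: dist_norm flip: scaleR_diff_right)
      finally show "infdist (c *\<^sub>R x) S / c \<le> dist x s"
        using that by (simp add: field_simps)
    qed
    then show ?thesis using that by (simp add: field_simps)
  qed
  ultimately show ?thesis by (simp add: sublinear_def)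
qed

theorem hahn_banach_separation:
  fixes S :: "'a::real_normed_vector set"
  assumes S: "subspace S" "closed S" and w: "w \<notin> S"
  obtains f :: "'a \<Rightarrow>\<^sub>L real" where "\<And>s. s \<in> S \<Longrightarrow> f s = 0" "f w \<noteq> 0"
proof -
  obtain f where f: "linear f" "\<And>x. f x \<le> infdist x S" "f w = infdist w S"
    using hahn_banach_sublinear[OF sublinear_infdist_subspace[OF S(1)]] by blast
  have fn: "f x \<le> norm x" for x
    using f(2)[of x] infdist_le[OF subspace_0[OF S(1)], of x] by simp
  have "\<bar>f x\<bar> \<le> norm x" for x
    using fn[of x] fn[of "- x"] linear_neg[OF f(1), of x] by simp
  then have bl: "bounded_linear f"
    using f(1) by (auto simp: linear_conv_bounded_linear bounded_linear_def
        bounded_linear_axioms_def intro!: exI[of _ 1])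
  have f0: "f s \<le> 0" if "s \<in> S" for s
    using f(2)[of s] that by simp
  show thesis
  proof (rule that[of "Blinfun f"])
    fix s assume s: "s \<in> S"
    then have "- s \<in> S" by (rule subspace_neg[OF S(1)])
    then have "f s = 0"
      using f0[of s] f0[of "- s"] linear_neg[OF f(1), of s] s by simp
    then show "Blinfun f s = 0"
      by (simp add: bounded_linear_Blinfun_apply[OF bl])
  next
    have "S \<noteq> {}" using subspace_0[OF S(1)] by auto
    then have "infdist w S > 0"
      using S w by (intro infdist_pos_not_in_closed) auto
    then show "Blinfun f w \<noteq> 0"
      using f(3) by (simp add: bounded_linear_Blinfun_apply[OF bl])
  qed
qed

section \<open>The open mapping theorem\<close>

text \<open>
  By Baire's theorem the closure of the image of some ball of \<open>M\<close> has an interior point. The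
  differences of two points near it fill a ball around the origin, and scaling it yields
  approximate solutions whose size is controlled by the right-hand side.
\<close>

lemma approximate_solutions:
  fixes f :: "'a::real_normed_vector \<Rightarrow>\<^sub>L 'b::banach"
  assumes M: "subspace M" and surj: "f ` M = UNIV"
  obtains C where "C > 0"
    "\<And>y. \<exists>x\<in>M. norm x \<le> C * norm y \<and> norm (y - f x) \<le> norm y / 2"
proof -
  define E where "E n = f ` (M \<inter> cball 0 (real n))" for n :: nat
  have cover: "(\<Union>n. closure (E n)) = UNIV"
  proof -
    have "y \<in> (\<Union>n. closure (E n))" for y
    proof -
      obtain x where x: "x \<in> M" "f x = y" using surj by (metis UNIV_I imageE)
      obtain n where "norm x \<le> real n" using real_arch_simple by blast
      with x have "y \<in> E n" by (auto simp: E_def)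
      then show ?thesis using closure_subset by blast
    qed
    then show ?thesis by auto
  qed
  have "\<exists>n. interior (closure (E n)) \<noteq> {}"
  proof (rule ccontr)
    assume "\<not> ?thesis"
    then have "euclidean interior_of \<Union>(range (\<lambda>n. closure (E n))) = {}"
      by (intro Baire_category_alt) (auto simp: completely_metrizable_space_euclidean)
    then show False using cover by simp
  qed
  then obtain n y0 where "y0 \<in> interior (closure (E n))" by blast
  then obtain r where r: "r > 0" "ball y0 r \<subseteq> closure (E n)"
    by (auto simp: mem_interior)
  have near: "\<exists>x\<in>M. norm x \<le> 2 * real n \<and> norm (y - f x) < e" if "norm y < r" "e > 0" for y e
  proof -
    have "y0 + y \<in> closure (E n)" "y0 \<in> closure (E n)"
      using r that by (auto simp: dist_norm subset_iff)
    then obtain u v where uv: "u \<in> E n" "v \<in> E n" "dist u (y0 + y) < e / 2" "dist v y0 < e / 2"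
      using \<open>e > 0\<close> by (meson closure_approachable half_gt_zero)
    then obtain a b where ab: "a \<in> M" "b \<in> M" "norm a \<le> n" "norm b \<le> n" "u = f a" "v = f b"
      by (auto simp: E_def)
    have "norm (y - f (a - b)) = norm (((y0 + y) - u) - (y0 - v))"
      using ab by (simp add: blinfun.diff_right algebra_simps)
    also have "\<dots> \<le> norm ((y0 + y) - u) + norm (y0 - v)" by (rule norm_triangle_ineq4)
    also have "\<dots> < e" using uv by (simp add: dist_norm norm_minus_commute)
    finally have "norm (y - f (a - b)) < e" .
    moreover have "norm (a - b) \<le> 2 * real n"
      using norm_triangle_ineq4[of a b] ab by simp
    moreover have "a - b \<in> M" using ab M by (simp add: subspace_diff)
    ultimately show ?thesis by blast
  qed
  \<comment> \<open>\<open>y\<close> is scaled to norm \<open>r / 2\<close> below, which turns the bound \<open>2 n\<close> into \<open>(4 n / r) \<parallel>y\<parallel>\<close>;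
    the summand 1 makes \<open>C\<close> positive even for \<open>n = 0\<close>.\<close>
  define C where "C = 4 * (real n + 1) / r"
  have C: "C > 0" using r by (simp add: C_def)
  have "\<exists>x\<in>M. norm x \<le> C * norm y \<and> norm (y - f x) \<le> norm y / 2" for y
  proof (cases "y = 0")
    case True
    then show ?thesis using subspace_0[OF M] by (intro bexI[of _ 0]) auto
  next
    case False
    define t where "t = r / (2 * norm y)"
    have t: "t > 0" using False r by (simp add: t_def)
    have "norm (t *\<^sub>R y) < r" using False r by (simp add: t_def)
    moreover have "t * (norm y / 2) > 0" using t False by simp
    ultimately obtain x where x: "x \<in> M" "norm x \<le> 2 * real n"
        "norm (t *\<^sub>R y - f x) < t * (norm y / 2)"
      using near by blast
    define z where "z = (1 / t) *\<^sub>R x"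
    have xz: "x = t *\<^sub>R z" using t by (simp add: z_def)
    have "t * norm (y - f z) = norm (t *\<^sub>R y - f x)"
      using t by (simp add: xz blinfun.scaleR_right flip: scaleR_diff_right)
    then have "t * norm (y - f z) < t * (norm y / 2)" using x by simp
    then have "norm (y - f z) \<le> norm y / 2" using t by simp
    moreover have "norm z \<le> C * norm y"
    proof -
      have "norm z = norm x / t" using t by (simp add: z_def)
      also have "\<dots> \<le> 2 * (real n + 1) / t" using x t by (intro divide_right_mono) auto
      also have "\<dots> = C * norm y" using False r by (simp add: C_def t_def)
      finally show ?thesis .
    qed
    moreover have "z \<in> M" using x M by (simp add: z_def subspace_scale)
    ultimately show ?thesis by blast
  qed
  with C show thesis by (rule that)
qed

text \<open>
  Solving again for the remaining error, the errors decay geometrically, so the corrections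
  form an absolutely convergent series; its sum is an exact solution and lies in \<open>M\<close> because
  \<open>M\<close> is closed.
\<close>

theorem open_mapping_subspace:
  fixes f :: "'a::banach \<Rightarrow>\<^sub>L 'b::banach"
  assumes M: "subspace M" "closed M" and surj: "f ` M = UNIV"
  obtains C where "\<And>y. \<exists>x\<in>M. f x = y \<and> norm x \<le> C * norm y"
proof -
  obtain C where C: "C > 0" and
    approx: "\<And>y. \<exists>x\<in>M. norm x \<le> C * norm y \<and> norm (y - f x) \<le> norm y / 2"
    using approximate_solutions[OF M(1) surj] by blast
  then obtain g where g: "\<And>y. g y \<in> M" "\<And>y. norm (g y) \<le> C * norm y"
      "\<And>y. norm (y - f (g y)) \<le> norm y / 2"
    by metis
  have "\<exists>x\<in>M. f x = y \<and> norm x \<le> (2 * C) * norm y" for y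
  proof -
    define e where "e n = ((\<lambda>y. y - f (g y)) ^^ n) y" for n
    have e0: "e 0 = y" and eS: "e (Suc n) = e n - f (g (e n))" for n
      by (simp_all add: e_def)
    have e: "norm (e n) \<le> norm y * (1 / 2) ^ n" for n
    proof (induction n)
      case (Suc n)
      have "norm (e (Suc n)) \<le> norm (e n) / 2" unfolding eS by (rule g)
      with Suc show ?case by simp
    qed (simp add: e0)
    define x where "x n = g (e n)" for n
    have x_le: "norm (x n) \<le> C * norm y * (1 / 2) ^ n" for n
    proof -
      have "norm (x n) \<le> C * norm (e n)" by (simp add: x_def g)
      also have "\<dots> \<le> C * (norm y * (1 / 2) ^ n)" using C e by (intro mult_left_mono) auto
      finally show ?thesis by (simp add: mult.assoc)
    qed
    have geo: "(\<lambda>n. C * norm y * (1 / 2) ^ n) sums (C * norm y * 2)"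
      using sums_mult[OF geometric_sums[of "1 / 2 :: real"]] by simp
    have sumn: "summable (\<lambda>n. norm (x n))"
      by (rule summable_comparison_test'[OF sums_summable[OF geo]]) (simp add: x_le)
    have lim: "(\<lambda>n. \<Sum>k<n. x k) \<longlonglongrightarrow> suminf x"
      using summable_norm_cancel[OF sumn] by (rule summable_LIMSEQ)
    have "f (\<Sum>k<n. x k) = y - e n" for n
      by (induction n) (simp_all add: e0 eS x_def blinfun.add_right)
    moreover have "e \<longlonglongrightarrow> 0"
    proof (rule Lim_null_comparison)
      show "\<forall>\<^sub>F n in sequentially. norm (e n) \<le> norm y * (1 / 2) ^ n" using e by simp
      show "(\<lambda>n. norm y * (1 / 2) ^ n) \<longlonglongrightarrow> 0"
        by (intro tendsto_mult_right_zero LIMSEQ_power_zero) simp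
    qed
    ultimately have "(\<lambda>n. f (\<Sum>k<n. x k)) \<longlonglongrightarrow> y - 0"
      by (simp only:) (intro tendsto_intros)
    moreover have "(\<lambda>n. f (\<Sum>k<n. x k)) \<longlonglongrightarrow> f (suminf x)"
      by (intro blinfun.tendsto tendsto_const lim)
    ultimately have "f (suminf x) = y"
      using LIMSEQ_unique by fastforce
    moreover have "suminf x \<in> M"
      using M(2) _ lim
      by (rule closed_sequentially) (simp add: x_def g M(1) subspace_sum)
    moreover have "norm (suminf x) \<le> (2 * C) * norm y"
    proof -
      have "norm (suminf x) \<le> (\<Sum>n. norm (x n))" by (rule summable_norm[OF sumn])
      also have "\<dots> \<le> (\<Sum>n. C * norm y * (1 / 2) ^ n)"
        by (intro suminf_le x_le sumn sums_summable[OF geo])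
      also have "\<dots> = (2 * C) * norm y" using sums_unique[OF geo] by simp
      finally show ?thesis .
    qed
    ultimately show ?thesis by blast
  qed
  then show thesis by (rule that)
qed

section \<open>Functionals and operators over the scalar field\<close>

context banach_space_over
begin

lemma subspace_imp_real_subspace:
  assumes "subspace S"
  shows "Real_Vector_Spaces.subspace S"
  using assms unfolding subspace_def Real_Vector_Spaces.subspace_def
  by (simp flip: smul_of_real)

lemma smul_scaleR: "smul c (r *\<^sub>R x) = r *\<^sub>R smul c x"
  by (simp add: mult.commute flip: smul_of_real)

lemma bounded_ops_uminus: "T \<in> bounded_ops smul \<Longrightarrow> - T \<in> bounded_ops smul"
  by (simp add: bounded_ops_def blinfun.minus_left)

lemma dual_space_compose:
  "f \<in> dual_space smul \<Longrightarrow> T \<in> bounded_ops smul \<Longrightarrow> f o\<^sub>L T \<in> dual_space smul"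
  by (simp add: bounded_ops_def dual_space_def)

lemma bounded_opsE:
  assumes add: "\<And>x y. f (x + y) = f x + f y"
    and scale: "\<And>c x. f (smul c x) = smul c (f x)"
    and bound: "\<And>x. norm (f x) \<le> norm x * C"
  obtains T where "T \<in> bounded_ops smul" "\<And>x. blinfun_apply T x = f x"
proof -
  have "bounded_linear f"
    using bound by (intro bounded_linear_intro[OF add]) (simp_all add: scale flip: smul_of_real)
  then have T: "Blinfun f x = f x" for x
    by (simp add: bounded_linear_Blinfun_apply)
  show thesis
    by (rule that[of "Blinfun f"]) (simp_all add: T bounded_ops_def scale)
qed

text \<open>
  A real functional \<open>u\<close> is the real part of the homogeneous functional \<open>u x - j u (j x)\<close>
  when the scalars contain an imaginary unit \<open>j\<close>.
\<close>

lemma real_functional_complexify: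
  fixes u :: "'a \<Rightarrow>\<^sub>L real"
  obtains g where "g \<in> dual_space smul"
    "\<And>x. (\<And>c. u (smul c x) = 0) \<Longrightarrow> g x = 0" "\<And>x. u x \<noteq> 0 \<Longrightarrow> g x \<noteq> 0"
proof -
  have smul_r: "smul (a *\<^sub>R 1) x = a *\<^sub>R x" for a x
    using smul_of_real[of a x] by (simp add: of_real_def)
  consider (real) "\<forall>z::'k. \<exists>a. z = a *\<^sub>R 1"
    | (complex) j :: 'k where "j * j = - 1" "\<forall>z. \<exists>a b. z = a *\<^sub>R 1 + b *\<^sub>R j"
        "\<forall>a b. norm (a *\<^sub>R 1 + b *\<^sub>R j) = sqrt (a\<^sup>2 + b\<^sup>2)"
    using real_or_complex by blast
  then show thesis
  proof cases
    case real
    define g :: "'a \<Rightarrow>\<^sub>L 'k" where "g = blinfun_scaleR_left 1 o\<^sub>L u"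
    have g: "g x = u x *\<^sub>R 1" for x by (simp add: g_def)
    have "g (smul c x) = c * g x" for c x
    proof -
      obtain a where "c = a *\<^sub>R 1" using real by blast
      then show ?thesis by (simp add: g smul_r blinfun.scaleR_right)
    qed
    moreover have "g x = 0" if "\<And>c. u (smul c x) = 0" for x
      using that[of 1] by (simp add: g)
    ultimately show thesis
      by (intro that[of g]) (auto simp: dual_space_def g)
  next
    case complex
    have "bounded_linear (smul j)"
      by (rule bounded_linear_intro[where K = "norm j"])
        (simp_all add: scale_right_distrib norm_smul smul_scaleR mult.commute)
    then have J: "Blinfun (smul j) x = smul j x" for x
      by (simp add: bounded_linear_Blinfun_apply)
    define g :: "'a \<Rightarrow>\<^sub>L 'k" where
      "g = (blinfun_scaleR_left 1 o\<^sub>L u) - (blinfun_scaleR_left j o\<^sub>L u o\<^sub>L Blinfun (smul j))"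
    have g: "g x = u x *\<^sub>R 1 + (- u (smul j x)) *\<^sub>R j" for x
      by (simp add: g_def J blinfun.diff_left)
    have "g (smul c x) = c * g x" for c x
    proof -
      obtain a b where c: "c = a *\<^sub>R 1 + b *\<^sub>R j" using complex by blast
      have cx: "smul c x = a *\<^sub>R x + b *\<^sub>R smul j x"
        unfolding c scale_left_distrib smul_r
        by (simp add: scaleR_conv_of_real flip: smul_of_real)
      have "smul j (smul j x) = - x"
        using complex(1) by simp
      then have jcx: "smul j (smul c x) = a *\<^sub>R smul j x - b *\<^sub>R x"
        unfolding cx scale_right_distrib
        by (simp add: smul_scaleR)
      have "g (smul c x) = (a * u x + b * u (smul j x)) *\<^sub>R 1 + (b * u x - a * u (smul j x)) *\<^sub>R j"
        unfolding g jcx by (simp add: cx blinfun.bilinear_simps)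
      also have "\<dots> = c * g x"
        unfolding g c using complex(1)
        by (simp add: algebra_simps)
      finally show ?thesis .
    qed
    moreover have "g x = 0" if "\<And>c. u (smul c x) = 0" for x
      using that[of 1] that[of j] by (simp add: g)
    moreover have "u x = 0" if "g x = 0" for x
    proof -
      have "sqrt ((u x)\<^sup>2 + (- u (smul j x))\<^sup>2) = 0"
        using that complex(3) unfolding g by (metis norm_zero)
      then show ?thesis by (simp add: sum_power2_eq_zero_iff)
    qed
    ultimately show thesis
      by (intro that[of g]) (auto simp: dual_space_def)
  qed
qed

theorem dual_space_separation:
  assumes S: "subspace S" "closed S" and w: "w \<notin> S"
  obtains f where "f \<in> dual_space smul" "\<And>s. s \<in> S \<Longrightarrow> f s = 0" "f w = 1"
proof -
  obtain u :: "'a \<Rightarrow>\<^sub>L real" where u: "\<And>s. s \<in> S \<Longrightarrow> u s = 0" "u w \<noteq> 0"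
    using hahn_banach_separation[OF subspace_imp_real_subspace[OF S(1)] S(2) w] by blast
  obtain g where g: "g \<in> dual_space smul"
      "\<And>x. (\<And>c. u (smul c x) = 0) \<Longrightarrow> g x = 0" "\<And>x. u x \<noteq> 0 \<Longrightarrow> g x \<noteq> 0"
    using real_functional_complexify by blast
  show thesis
  proof (rule that[of "blinfun_mult_right (inverse (g w)) o\<^sub>L g"])
    show "blinfun_mult_right (inverse (g w)) o\<^sub>L g \<in> dual_space smul"
      using g(1) by (simp add: dual_space_def)
    show "(blinfun_mult_right (inverse (g w)) o\<^sub>L g) s = 0" if "s \<in> S" for s
      using that u(1) g(2)[of s] subspace_scale[OF S(1)] by simp
    show "(blinfun_mult_right (inverse (g w)) o\<^sub>L g) w = 1"
      using g(3)[OF u(2)] by simp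
  qed
qed

text \<open>The span is the set of fixed points of a continuous map.\<close>

lemma closed_span_if_coordinates:
  assumes coord: "\<And>x. x \<in> span F \<Longrightarrow> x = (\<Sum>y\<in>F. smul (blinfun_apply (g y) x) y)"
  shows "closed (span F)"
proof -
  have bl: "bounded_linear (\<lambda>c. smul c y)" for y
    by (rule bounded_linear_intro[where K = "norm y"])
      (simp_all add: scale_left_distrib norm_smul scaleR_conv_of_real flip: smul_of_real)
  have "span F = {x. x = (\<Sum>y\<in>F. smul (g y x) y)}"
  proof (intro set_eqI iffI CollectI)
    fix x assume "x \<in> {x. x = (\<Sum>y\<in>F. smul (g y x) y)}"
    then have "x = (\<Sum>y\<in>F. smul (g y x) y)" by blast
    moreover have "(\<Sum>y\<in>F. smul (g y x) y) \<in> span F"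
      by (intro span_sum span_scale span_base)
    ultimately show "x \<in> span F" by simp
  qed (rule coord)
  moreover have "continuous_on UNIV (\<lambda>x. \<Sum>y\<in>F. smul (g y x) y)"
    by (intro continuous_on_sum bounded_linear.continuous_on[OF bl] continuous_intros)
  ultimately show ?thesis
    by (simp add: closed_Collect_eq)
qed

text \<open>
  Adding a vector \<open>v\<close> outside \<open>span F\<close>, a functional \<open>h\<close> that vanishes on this closed subspace
  and has \<open>h v = 1\<close> reads off the new coordinate; the old functionals are corrected by
  multiples of \<open>h\<close> so that they ignore \<open>v\<close>.
\<close>

lemma coordinate_functionals:
  assumes "finite F"
  obtains g where "\<And>y. g y \<in> dual_space smul"
    "\<And>x. x \<in> span F \<Longrightarrow> x = (\<Sum>y\<in>F. smul (blinfun_apply (g y) x) y)"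
proof -
  from assms have "\<exists>g. (\<forall>y. g y \<in> dual_space smul) \<and>
      (\<forall>x\<in>span F. x = (\<Sum>y\<in>F. smul (blinfun_apply (g y) x) y))"
  proof (induction F)
    case empty
    show ?case by (intro exI[of _ "\<lambda>_. 0"]) (simp add: dual_space_def)
  next
    case (insert v F)
    then obtain g where g: "\<And>y. g y \<in> dual_space smul"
        "\<And>x. x \<in> span F \<Longrightarrow> x = (\<Sum>y\<in>F. smul (blinfun_apply (g y) x) y)" by blast
    show ?case
    proof (cases "v \<in> span F")
      case True
      then have sp: "span (insert v F) = span F" by (rule span_redundant)
      define g' where "g' = g(v := 0)"
      have "(\<Sum>y\<in>insert v F. smul (g' y x) y) = (\<Sum>y\<in>F. smul (g y x) y)" for x
        using insert by (auto simp: g'_def intro!: sum.cong)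
      moreover have "g' y \<in> dual_space smul" for y
        using g by (simp add: g'_def dual_space_def)
      ultimately show ?thesis using g(2) unfolding sp by metis
    next
      case False
      have "closed (span F)" using g(2) by (rule closed_span_if_coordinates)
      then obtain h where h: "h \<in> dual_space smul" "\<And>s. s \<in> span F \<Longrightarrow> h s = 0" "h v = 1"
        using dual_space_separation[OF subspace_span _ False] by blast
      define g' where "g' = (\<lambda>y. g y - (blinfun_mult_right (g y v) o\<^sub>L h))(v := h)"
      have "g' y \<in> dual_space smul" for y
        using g h by (simp add: g'_def dual_space_def blinfun.diff_left algebra_simps)
      moreover have "x = (\<Sum>y\<in>insert v F. smul (g' y x) y)" if x_in: "x \<in> span (insert v F)" for x
      proof -
        obtain c where "x - smul c v \<in> span F"
          using x_in unfolding span_insert by blast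
        moreover define s where "s = x - smul c v"
        ultimately have s: "s \<in> span F" and x: "x = smul c v + s" by simp_all
        have hx: "h x = c"
          using h s by (simp add: x blinfun.add_right dual_space_def)
        have "g' y x = g y s" if "y \<in> F" for y
        proof -
          have "y \<noteq> v" using that insert by auto
          then show ?thesis
            using g(1)[of y] by (simp add: g'_def blinfun.diff_left hx)
              (simp add: x blinfun.add_right dual_space_def)
        qed
        then have "(\<Sum>y\<in>F. smul (g' y x) y) = s"
          using g(2)[OF s] by simp
        moreover have "g' v x = c" by (simp add: g'_def hx)
        ultimately show ?thesis
          using insert by (simp add: x)
      qed
      ultimately show ?thesis by blast
    qed
  qed
  then show thesis using that by blast
qed

lemma closed_span_finite:
  assumes "finite F"
  shows "closed (span F)"
  by (rule coordinate_functionals[OF assms]) (rule closed_span_if_coordinates)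

lemma finite_rank_projection:
  assumes F: "finite F"
  obtains R where "R \<in> bounded_ops smul" "range R \<subseteq> span F" "\<And>x. x \<in> span F \<Longrightarrow> R x = x"
proof -
  obtain g where g: "\<And>y. g y \<in> dual_space smul"
      "\<And>x. x \<in> span F \<Longrightarrow> x = (\<Sum>y\<in>F. smul (blinfun_apply (g y) x) y)"
    using coordinate_functionals[OF F] by blast
  define f where "f x = (\<Sum>y\<in>F. smul (g y x) y)" for x
  have "f (x + y) = f x + f y" for x y
    by (simp add: f_def blinfun.add_right scale_left_distrib sum.distrib)
  moreover have "f (smul c x) = smul c (f x)" for c x
    using g(1) by (simp add: f_def dual_space_def scale_sum_right)
  moreover have "norm (f x) \<le> norm x * (\<Sum>y\<in>F. norm (g y) * norm y)" for x
  proof -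
    have "norm (f x) \<le> (\<Sum>y\<in>F. norm (smul (g y x) y))"
      unfolding f_def by (rule norm_sum)
    also have "\<dots> \<le> (\<Sum>y\<in>F. norm (g y) * norm x * norm y)"
      by (intro sum_mono) (simp add: norm_smul mult_right_mono norm_blinfun)
    finally show ?thesis by (simp add: sum_distrib_left mult_ac)
  qed
  ultimately obtain R where R: "R \<in> bounded_ops smul" "\<And>x. blinfun_apply R x = f x"
    by (rule bounded_opsE) blast
  moreover have "range R \<subseteq> span F"
    by (auto simp: R f_def intro!: span_sum) (intro span_scale span_base)
  moreover have "R x = x" if "x \<in> span F" for x
    using g(2)[OF that] by (simp add: R f_def)
  ultimately show thesis by (intro that)
qed

text \<open>
  The vectors of \<open>F\<close> are added to \<open>G\<close> one at a time. A new vector is dropped if it already lies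
  in \<open>R + span G\<close>; otherwise no element of \<open>R\<close> is the sum of a nonzero multiple of it and an
  element of \<open>span G\<close>, so that the sum stays direct.
\<close>

lemma direct_finite_complement:
  assumes R: "subspace R" and F: "finite F" and sum: "\<And>x. \<exists>r\<in>R. x - r \<in> span F"
  obtains G where "finite G" "\<And>x. \<exists>r\<in>R. x - r \<in> span G" "R \<inter> span G = {0}"
proof -
  from F have "\<exists>G. finite G \<and> R \<inter> span G = {0} \<and> (\<forall>x\<in>span F. \<exists>r\<in>R. x - r \<in> span G)"
  proof (induction F)
    case empty
    show ?case
      using subspace_0[OF R] by (intro exI[of _ "{}"]) auto
  next
    case (insert v F)
    then obtain G where G: "finite G" "R \<inter> span G = {0}"
        "\<And>x. x \<in> span F \<Longrightarrow> \<exists>r\<in>R. x - r \<in> span G" by blast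
    \<comment> \<open>Modulo \<open>R + span G\<close> only the multiples of \<open>v\<close> remain to be represented.\<close>
    have dec: "\<exists>c. \<exists>r\<in>R. x - smul c v - r \<in> span G" if x: "x \<in> span (insert v F)" for x
      using that G(3) unfolding span_insert by blast
    show ?case
    proof (cases "\<exists>r\<in>R. v - r \<in> span G")
      case True
      then obtain r0 where r0: "r0 \<in> R" "v - r0 \<in> span G" by blast
      have "\<exists>r\<in>R. x - r \<in> span G" if x: "x \<in> span (insert v F)" for x
      proof -
        obtain c r where r: "r \<in> R" "x - smul c v - r \<in> span G"
          using dec[OF x] by blast
        have "(x - smul c v - r) + smul c (v - r0) \<in> span G"
          by (intro span_add r span_scale r0)
        moreover have "r + smul c r0 \<in> R"
          using r r0 R by (simp add: subspace_add subspace_scale)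
        ultimately show ?thesis
          by (intro bexI[of _ "r + smul c r0"]) (simp_all add: scale_right_diff_distrib algebra_simps)
      qed
      with G show ?thesis by blast
    next
      case False
      have "x = 0" if x: "x \<in> R" "x \<in> span (insert v G)" for x
      proof -
        obtain c where c: "x - smul c v \<in> span G"
          using x(2) unfolding span_insert by blast
        have "c = 0"
        proof (rule ccontr)
          assume c0: "c \<noteq> 0"
          have "smul (- inverse c) (x - smul c v) \<in> span G"
            using c by (rule span_scale)
          moreover have "smul (- inverse c) (x - smul c v) = v - smul (inverse c) x"
            using c0 by (simp add: scale_right_diff_distrib)
          ultimately show False
            using False subspace_scale[OF R x(1)] by metis
        qed
        then have "x \<in> R \<inter> span G" using c x by simp
        then show ?thesis using G by simp
      qed
      then have "R \<inter> span (insert v G) = {0}"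
        using subspace_0[OF R] span_zero by auto
      moreover have "\<exists>r\<in>R. x - r \<in> span (insert v G)" if x: "x \<in> span (insert v F)" for x
      proof -
        obtain c r where r: "r \<in> R" "x - smul c v - r \<in> span G"
          using dec[OF x] by blast
        then have "x - r - smul c v \<in> span G" by (simp add: algebra_simps)
        then show ?thesis using r(1) unfolding span_insert by blast
      qed
      ultimately show ?thesis using G(1) by (intro exI[of _ "insert v G"]) auto
    qed
  qed
  then obtain G where G: "finite G" "R \<inter> span G = {0}"
      "\<And>x. x \<in> span F \<Longrightarrow> \<exists>r\<in>R. x - r \<in> span G" by blast
  have "\<exists>r\<in>R. x - r \<in> span G" for x
  proof -
    obtain r where r: "r \<in> R" "x - r \<in> span F" using sum by blast
    then obtain r' where r': "r' \<in> R" "x - r - r' \<in> span G" using G(3) by blast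
    then show ?thesis
      using r subspace_add[OF R, of r r'] by (intro bexI[of _ "r + r'"]) (auto simp: algebra_simps)
  qed
  with G show thesis by (intro that[of G])
qed

end

section \<open>Fredholm operators are invertible at infinity\<close>

context banach_space_over
begin

text \<open>
  With \<open>span G\<close> a finite-dimensional algebraic complement of the range and \<open>R\<close> a bounded
  projection onto the kernel, the map \<open>(x, w) \<mapsto> A x + w\<close> is a bijection from the Banach space
  \<open>M = ker R \<times> span G\<close> onto the whole space. Its inverse \<open>S\<close> is bounded by the open mapping
  theorem, and its first component is the desired regularizer: the errors are the second
  component of \<open>S\<close> and the projection \<open>R\<close>, up to sign.
\<close>

lemma fredholm_regularizer:
  assumes A: "A \<in> bounded_ops smul" and fred: "fredholm smul A"
  obtains B T1 T2 F1 F2 where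
    "B \<in> bounded_ops smul" "T1 \<in> bounded_ops smul" "T2 \<in> bounded_ops smul"
    "finite F1" "range T1 \<subseteq> span F1" "finite F2" "range T2 \<subseteq> span F2"
    "A o\<^sub>L B = id_blinfun + T1" "B o\<^sub>L A = id_blinfun + T2"
proof -
  have A_smul: "A (smul c x) = smul c (A x)" for c x
    using A by (simp add: bounded_ops_def)
  obtain F where F: "finite F" "{x. A x = 0} = span F"
    using fred by (auto simp: fredholm_def finite_dimensional_def)
  obtain F' where F': "finite F'"
      "range (\<lambda>x. (+) x ` range A) = (\<lambda>x. (+) x ` range A) ` span F'"
    using fred by (auto simp: fredholm_def finite_dimensional_quotient_def)
  have sR: "subspace (range A)"
    by (auto simp: subspace_def image_iff) (metis blinfun.zero_right, metis blinfun.add_right,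
        metis A_smul)
  have "\<exists>r\<in>range A. x - r \<in> span F'" for x
  proof -
    have "(+) x ` range A \<in> (\<lambda>x. (+) x ` range A) ` span F'"
      unfolding F'(2)[symmetric] by (rule rangeI)
    then obtain z where z: "z \<in> span F'" "(+) x ` range A = (+) z ` range A" by blast
    have "x + A 0 \<in> (+) z ` range A" unfolding z(2)[symmetric] by blast
    then obtain w where "x = z + A w" by auto
    then show ?thesis using z(1) by (intro bexI[of _ "A w"]) auto
  qed
  then obtain G where G: "finite G" "\<And>x. \<exists>r\<in>range A. x - r \<in> span G" "range A \<inter> span G = {0}"
    using direct_finite_complement[OF sR F'(1)] by blast
  obtain R where R: "R \<in> bounded_ops smul" "range R \<subseteq> span F" "\<And>x. x \<in> span F \<Longrightarrow> R x = x"
    using finite_rank_projection[OF F(1)] by blast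
  have R_smul: "R (smul c x) = smul c (R x)" for c x
    using R(1) by (simp add: bounded_ops_def)
  have AR: "A (R x) = 0" for x
    using R(2) F(2) by blast
  have RR: "R (R x) = R x" for x
    using R(2,3) by blast
  define M where "M = {z. R (fst z) = 0 \<and> snd z \<in> span G}"
  define f where "f = (A o\<^sub>L fst_blinfun) + snd_blinfun"
  have f: "f z = A (fst z) + snd z" for z
    by (simp add: f_def blinfun.add_left)
  have M_add: "z + z' \<in> M" if "z \<in> M" "z' \<in> M" for z z'
    using that by (auto simp: M_def blinfun.add_right span_add)
  have M_smul: "(smul c x, smul c w) \<in> M" if "(x, w) \<in> M" for c x w
    using that by (auto simp: M_def R_smul span_scale)
  have sM: "Real_Vector_Spaces.subspace M"
    unfolding Real_Vector_Spaces.subspace_def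
  proof (intro conjI ballI allI)
    show "0 \<in> M" by (simp add: M_def span_zero)
    show "c *\<^sub>R z \<in> M" if "z \<in> M" for c z
      using M_smul[of "fst z" "snd z" "of_real c"] that
      by (simp add: smul_of_real flip: scaleR_prod_def)
  qed (rule M_add)
  have "M = {z. R (fst z) = 0} \<inter> snd -` span G" by (auto simp: M_def)
  moreover have "closed {z :: 'a \<times> 'a. R (fst z) = 0}"
    by (intro closed_Collect_eq continuous_intros)
  moreover have "closed (snd -` span G :: ('a \<times> 'a) set)"
    by (intro closed_vimage closed_span_finite G continuous_intros)
  ultimately have cM: "closed M" by auto
  have surj: "f ` M = UNIV"
  proof -
    have "y \<in> f ` M" for y
    proof -
      obtain x where x: "y - A x \<in> span G" using G(2)[of y] by auto
      \<comment> \<open>Subtracting \<open>R x\<close> moves the preimage into \<open>ker R\<close> without changing its image under \<open>A\<close>.\<close>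
      have "(x - R x, y - A x) \<in> M"
        using x by (simp add: M_def blinfun.diff_right RR)
      moreover have "f (x - R x, y - A x) = y"
        by (simp add: f blinfun.diff_right AR)
      ultimately show ?thesis by (metis imageI)
    qed
    then show ?thesis by auto
  qed
  obtain C where C: "\<And>y. \<exists>z\<in>M. f z = y \<and> norm z \<le> C * norm y"
    using open_mapping_subspace[OF sM cM surj] by blast
  have inj: "z = z'" if z: "z \<in> M" "z' \<in> M" "f z = f z'" for z z'
  proof -
    obtain x w x' w' where zz: "z = (x, w)" "z' = (x', w')" by (cases z, cases z')
    have "A (x - x') = w' - w"
      using z(3) by (simp add: zz f blinfun.diff_right algebra_simps)
    moreover have "w' - w \<in> span G"
      using z(1,2) by (simp add: zz M_def span_diff)
    ultimately have "w' - w \<in> range A \<inter> span G" by (metis IntI rangeI)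
    then have w: "w' - w = 0" using G(3) by blast
    then have "x - x' \<in> span F"
      using \<open>A (x - x') = w' - w\<close> F(2) by auto
    then have "R (x - x') = x - x'" by (rule R(3))
    then have "x - x' = 0"
      using z(1,2) by (simp add: zz M_def blinfun.diff_right)
    with w show ?thesis by (simp add: zz)
  qed
  obtain S where S: "\<And>y. S y \<in> M" "\<And>y. f (S y) = y" "\<And>y. norm (S y) \<le> C * norm y"
    using C by metis
  have S_eq: "S y = z" if "z \<in> M" "f z = y" for y z
    using inj[OF S(1) that(1)] S(2) that(2) by simp
  define b where "b y = fst (S y)" for y
  define t where "t y = snd (S y)" for y
  have Sbt: "S y = (b y, t y)" for y by (simp add: b_def t_def)
  have S_add: "S (y + y') = S y + S y'" for y y'
    by (rule S_eq) (simp_all add: M_add S blinfun.add_right)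
  have S_smul: "S (smul c y) = (smul c (b y), smul c (t y))" for c y
  proof (rule S_eq)
    show "(smul c (b y), smul c (t y)) \<in> M"
      using S(1)[of y] by (intro M_smul) (simp add: Sbt)
    show "f (smul c (b y), smul c (t y)) = smul c y"
      using S(2)[of y] by (simp add: Sbt f A_smul flip: scale_right_distrib)
  qed
  have "norm (b y) \<le> norm y * C" for y
    using norm_fst_le[of "b y" "t y"] S(3)[of y] by (simp add: Sbt mult.commute)
  then obtain B where B: "B \<in> bounded_ops smul" "\<And>y. blinfun_apply B y = b y"
    using bounded_opsE[of b C] S_add S_smul by (auto simp: Sbt)
  have "norm (t y) \<le> norm y * C" for y
    using norm_snd_le[of "t y" "b y"] S(3)[of y] by (simp add: Sbt mult.commute)
  then obtain T where T: "T \<in> bounded_ops smul" "\<And>y. blinfun_apply T y = t y"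
    using bounded_opsE[of t C] S_add S_smul by (auto simp: Sbt)
  show thesis
  proof (rule that)
    show "B \<in> bounded_ops smul" "- T \<in> bounded_ops smul" "- R \<in> bounded_ops smul"
      using B T R by (auto intro: bounded_ops_uminus)
    show "finite G" "finite F" by (fact G F)+
    show "range (- T) \<subseteq> span G"
      using S(1) by (auto simp: T Sbt M_def blinfun.minus_left intro: span_neg)
    show "range (- R) \<subseteq> span F"
      using R(2) by (auto simp: blinfun.minus_left intro: span_neg)
    show "A o\<^sub>L B = id_blinfun + - T"
    proof (rule blinfun_eqI)
      fix y
      have "A (b y) + t y = y" using S(2)[of y] by (simp add: Sbt f)
      then show "(A o\<^sub>L B) y = (id_blinfun + - T) y"
        by (simp add: B T blinfun.bilinear_simps algebra_simps)
    qed
    show "B o\<^sub>L A = id_blinfun + - R"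
    proof (rule blinfun_eqI)
      fix x
      have "S (A x) = (x - R x, 0)"
        by (rule S_eq) (simp_all add: M_def f blinfun.diff_right RR AR span_zero)
      then show "(B o\<^sub>L A) x = (id_blinfun + - R) x"
        by (simp add: B Sbt blinfun.bilinear_simps)
    qed
  qed
qed

end

context approx_projections
begin

lemma norm_P_le: "norm (P n) \<le> 1"
proof (rule norm_blinfun_bound)
  fix x
  have "norm (P n x) \<le> (SUP n. norm (P n x))"
    by (rule cSUP_upper) (simp_all add: P_bdd)
  then show "norm (P n x) \<le> 1 * norm x" by (simp add: P_sup)
qed simp

lemma P_in_P_compact_ops: "P m \<in> P_compact_ops smul P"
proof -
  obtain N where N: "\<And>n. n \<ge> N \<Longrightarrow> P n o\<^sub>L P m = P m \<and> P m o\<^sub>L P n = P m"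
    using P_absorb by blast
  have comp: "P m o\<^sub>L co_proj P n = P m - (P m o\<^sub>L P n)" "co_proj P n o\<^sub>L P m = P m - (P n o\<^sub>L P m)" for n
    by (auto intro!: blinfun_eqI simp: co_proj_def blinfun.bilinear_simps)
  have "\<forall>\<^sub>F n in sequentially. norm (P m o\<^sub>L co_proj P n) = 0 \<and> norm (co_proj P n o\<^sub>L P m) = 0"
    unfolding comp by (rule eventually_sequentiallyI[of N]) (simp add: N)
  then have "(\<lambda>n. norm (P m o\<^sub>L co_proj P n)) \<longlonglongrightarrow> 0" "(\<lambda>n. norm (co_proj P n o\<^sub>L P m)) \<longlonglongrightarrow> 0"
    by (auto intro!: tendsto_eventually elim: eventually_mono)
  then show ?thesis by (simp add: P_compact_ops_def P_op)
qed

text \<open>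
  A finite-rank operator is a finite sum of operators \<open>x \<mapsto> f x \<cdot> y\<close> with \<open>f\<close> in the dual
  space. Multiplying such an operator by \<open>Q\<^sub>n\<close> from the left changes \<open>y\<close> to \<open>Q\<^sub>n y\<close>, and
  from the right \<open>f\<close> to the image of \<open>f\<close> under the adjoint of \<open>Q\<^sub>n\<close>; perfectness is exactly
  the convergence of both to zero.
\<close>

lemma finite_rank_in_P_compact_ops:
  assumes perf: "perfect smul P" and T: "T \<in> bounded_ops smul"
    and F: "finite F" "range T \<subseteq> span F"
  shows "T \<in> P_compact_ops smul P"
proof -
  obtain g where g: "\<And>y. g y \<in> dual_space smul"
      "\<And>x. x \<in> span F \<Longrightarrow> x = (\<Sum>y\<in>F. smul (blinfun_apply (g y) x) y)"
    using coordinate_functionals[OF F(1)] by blast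
  define f where "f y = g y o\<^sub>L T" for y
  have f: "f y \<in> dual_space smul" for y
    unfolding f_def using g(1) T by (rule dual_space_compose)
  have Tx: "T x = (\<Sum>y\<in>F. smul (f y x) y)" for x
    using g(2)[of "T x"] F(2) by (auto simp: f_def)
  have Q_smul: "co_proj P n (smul c x) = smul c (co_proj P n x)" for n c x
    using P_op[of n] by (simp add: co_proj_def bounded_ops_def blinfun.diff_left scale_right_diff_distrib)
  have right: "norm (T o\<^sub>L co_proj P n) \<le> (\<Sum>y\<in>F. norm (f y - dual_op (P n) (f y)) * norm y)" for n
  proof (rule norm_blinfun_bound)
    fix x
    have "f y (co_proj P n x) = (f y - dual_op (P n) (f y)) x" for y
      by (simp add: co_proj_def dual_op_def blinfun.bilinear_simps)
    then have "norm ((T o\<^sub>L co_proj P n) x) = norm (\<Sum>y\<in>F. smul ((f y - dual_op (P n) (f y)) x) y)"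
      by (simp add: Tx)
    also have "\<dots> \<le> (\<Sum>y\<in>F. norm (f y - dual_op (P n) (f y)) * norm x * norm y)"
      by (rule sum_norm_le) (simp only: norm_smul, intro mult_right_mono norm_blinfun norm_ge_zero)
    finally show "norm ((T o\<^sub>L co_proj P n) x)
        \<le> (\<Sum>y\<in>F. norm (f y - dual_op (P n) (f y)) * norm y) * norm x"
      by (simp add: sum_distrib_left sum_distrib_right mult_ac)
  qed (simp add: sum_nonneg)
  have left: "norm (co_proj P n o\<^sub>L T) \<le> (\<Sum>y\<in>F. norm (f y) * norm (y - P n y))" for n
  proof (rule norm_blinfun_bound)
    fix x
    have "norm ((co_proj P n o\<^sub>L T) x) = norm (\<Sum>y\<in>F. smul (f y x) (y - P n y))"
      by (simp add: Tx blinfun.sum_right Q_smul) (simp add: co_proj_def blinfun.diff_left)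
    also have "\<dots> \<le> (\<Sum>y\<in>F. norm (f y) * norm x * norm (y - P n y))"
      by (rule sum_norm_le) (simp only: norm_smul, intro mult_right_mono norm_blinfun norm_ge_zero)
    finally show "norm ((co_proj P n o\<^sub>L T) x) \<le> (\<Sum>y\<in>F. norm (f y) * norm (y - P n y)) * norm x"
      by (simp add: sum_distrib_left sum_distrib_right mult_ac)
  qed (simp add: sum_nonneg)
  have "(\<lambda>n. f y - dual_op (P n) (f y)) \<longlonglongrightarrow> f y - f y" for y
    using perf f by (intro tendsto_intros) (simp add: perfect_def)
  then have "(\<lambda>n. \<Sum>y\<in>F. norm (f y - dual_op (P n) (f y)) * norm y) \<longlonglongrightarrow> 0"
    by (intro tendsto_null_sum tendsto_mult_left_zero tendsto_norm_zero) simp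
  then have "(\<lambda>n. norm (T o\<^sub>L co_proj P n)) \<longlonglongrightarrow> 0"
    by (rule Lim_null_comparison[rotated]) (simp add: right)
  moreover have "(\<lambda>n. y - P n y) \<longlonglongrightarrow> y - y" for y
    using perf by (intro tendsto_intros) (simp add: perfect_def)
  then have "(\<lambda>n. \<Sum>y\<in>F. norm (f y) * norm (y - P n y)) \<longlonglongrightarrow> 0"
    by (intro tendsto_null_sum tendsto_mult_right_zero tendsto_norm_zero) simp
  then have "(\<lambda>n. norm (co_proj P n o\<^sub>L T)) \<longlonglongrightarrow> 0"
    by (rule Lim_null_comparison[rotated]) (simp add: left)
  ultimately show ?thesis
    using T by (simp add: P_compact_ops_def)
qed

theorem fredholm_imp_invertible_at_infinity:
  assumes "perfect smul P" "A \<in> bounded_ops smul" "fredholm smul A"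
  shows "invertible_at_infinity smul P A"
  using fredholm_regularizer[OF assms(2,3)] finite_rank_in_P_compact_ops[OF assms(1)]
  unfolding invertible_at_infinity_def by metis

end

section \<open>Limit operators of operators invertible at infinity\<close>

lemma max_norm_uminus: "max_norm (- k) = max_norm k"
  by (simp add: max_norm_def)

text \<open>
  The lower bound for \<open>L\<close> makes \<open>L\<close> injective with closed range. The lower bound for the
  adjoint leaves no nonzero functional that vanishes on the range, so by the separation theorem
  the range is everything.
\<close>

lemma (in banach_space_over) bij_if_bounded_below:
  assumes L: "L \<in> bounded_ops smul"
    and below: "\<And>x. norm x \<le> b * norm (L x)"
    and below_dual: "\<And>f. f \<in> dual_space smul \<Longrightarrow> norm f \<le> b * norm (f o\<^sub>L L)"
  shows "bij (blinfun_apply L)"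
proof (rule bijI)
  show inj: "inj L"
  proof (rule injI)
    fix x y assume "L x = L y"
    then have "norm (x - y) \<le> 0" using below[of "x - y"] by (simp add: blinfun.diff_right)
    then show "x = y" by simp
  qed
  have L_smul: "L (smul c x) = smul c (L x)" for c x
    using L by (simp add: bounded_ops_def)
  have sub: "subspace (range L)"
    by (auto simp: subspace_def image_iff) (metis blinfun.zero_right, metis blinfun.add_right,
        metis L_smul)
  have "complete (range L)"
  proof (rule completeI)
    fix s assume s: "\<forall>n. s n \<in> range L" "Cauchy s"
    then have "\<forall>n. \<exists>x. s n = L x" by blast
    then obtain z where z: "\<And>n. s n = L (z n)" by (auto dest: choice)
    have "Cauchy z"
    proof (rule CauchyI)
      fix e :: real assume e: "e > 0"
      have "e / (\<bar>b\<bar> + 1) > 0" using e by simp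
      then obtain N where N: "\<And>m n. m \<ge> N \<Longrightarrow> n \<ge> N \<Longrightarrow> norm (s m - s n) < e / (\<bar>b\<bar> + 1)"
        using CauchyD[OF s(2)] by blast
      have "norm (z m - z n) < e" if "m \<ge> N" "n \<ge> N" for m n
      proof -
        have "norm (z m - z n) \<le> b * norm (s m - s n)"
          using below[of "z m - z n"] by (simp add: z blinfun.diff_right)
        also have "\<dots> \<le> (\<bar>b\<bar> + 1) * norm (s m - s n)" by (intro mult_right_mono) auto
        also have "\<dots> < e" using N[OF that] by (simp add: field_simps)
        finally show ?thesis .
      qed
      then show "\<exists>N. \<forall>m\<ge>N. \<forall>n\<ge>N. norm (z m - z n) < e" by blast
    qed
    then obtain l where "z \<longlonglongrightarrow> l" using Cauchy_convergent convergent_def by blast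
    then have "(\<lambda>n. L (z n)) \<longlonglongrightarrow> L l" by (intro blinfun.tendsto tendsto_const)
    then show "\<exists>l\<in>range L. s \<longlonglongrightarrow> l" by (auto simp flip: z)
  qed
  then have closed: "closed (range L)" by (rule complete_imp_closed)
  have "w \<in> range L" for w
  proof (rule ccontr)
    assume "w \<notin> range L"
    then obtain f where f: "f \<in> dual_space smul" "\<And>s. s \<in> range L \<Longrightarrow> f s = 0" "f w = 1"
      using dual_space_separation[OF sub closed] by blast
    have "f o\<^sub>L L = 0" using f(2) by (intro blinfun_eqI) simp
    then have "norm f \<le> 0" using below_dual[OF f(1)] by simp
    then show False using f(3) by simp
  qed
  then show "surj L" by blast
qed

context shift_setting
begin

lemma norm_V_le: "norm (V k) \<le> 1"
  by (rule norm_blinfun_bound) (simp_all add: V_isometry)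

lemma norm_compose_V_le: "norm (T o\<^sub>L V k) \<le> norm T" "norm (V k o\<^sub>L T) \<le> norm T"
  using norm_blinfun_compose[of T "V k"] norm_blinfun_compose[of "V k" T] norm_V_le[of k]
    mult_left_le[of "norm (V k)" "norm T"] mult_left_le_one_le[of "norm T" "norm (V k)"]
  by auto

lemma V_inverse: "V k o\<^sub>L V (- k) = id_blinfun"
  by (simp add: V_add V_zero)

text \<open>
  Operators in \<open>K(Y,P)\<close> live, up to a small error, on the range of some \<open>P\<^sub>l\<close>, and shifts
  far out move this range away from that of \<open>P\<^sub>m\<close>.
\<close>

lemma P_compact_shift_tendsto_0:
  assumes T: "T \<in> P_compact_ops smul P" and m: "m \<ge> 1"
    and h: "filterlim (\<lambda>n. max_norm (h n)) at_top sequentially"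
  shows "(\<lambda>n. norm (T o\<^sub>L V (h n) o\<^sub>L P m)) \<longlonglongrightarrow> 0"
    and "(\<lambda>n. norm (P m o\<^sub>L V (h n) o\<^sub>L T)) \<longlonglongrightarrow> 0"
proof -
  have small: "(\<lambda>n. norm (X n)) \<longlonglongrightarrow> 0"
    if bound: "\<And>e. e > 0 \<Longrightarrow> \<exists>k0. \<forall>n. max_norm (h n) > k0 \<longrightarrow> norm (X n) < e"
    for X :: "nat \<Rightarrow> 'a \<Rightarrow>\<^sub>L 'a"
  proof (rule tendstoI)
    fix e :: real assume "e > 0"
    then obtain k0 where k0: "\<forall>n. max_norm (h n) > k0 \<longrightarrow> norm (X n) < e"
      using bound by blast
    have "\<forall>\<^sub>F n in sequentially. max_norm (h n) \<ge> k0 + 1"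
      using h by (simp add: filterlim_at_top)
    then show "\<forall>\<^sub>F n in sequentially. dist (norm (X n)) 0 < e"
      by eventually_elim (simp add: k0)
  qed
  have large: "\<exists>l\<ge>1. norm (Y l) < e" if "(\<lambda>n. norm (Y n)) \<longlonglongrightarrow> 0" "e > 0"
    for Y :: "nat \<Rightarrow> 'a \<Rightarrow>\<^sub>L 'a" and e
  proof -
    have "\<forall>\<^sub>F l in sequentially. norm (Y l) < e"
      using tendstoD[OF that] by simp
    then have "\<forall>\<^sub>F l in sequentially. norm (Y l) < e \<and> l \<ge> 1"
      using eventually_ge_at_top by (rule eventually_conj)
    then show ?thesis using eventually_happens' sequentially_bot by blast
  qed
  show "(\<lambda>n. norm (T o\<^sub>L V (h n) o\<^sub>L P m)) \<longlonglongrightarrow> 0"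
  proof (rule small)
    fix e :: real assume "e > 0"
    then obtain l where l: "l \<ge> 1" "norm (T o\<^sub>L co_proj P l) < e"
      using large[of "\<lambda>n. T o\<^sub>L co_proj P n"] T unfolding P_compact_ops_def by blast
    obtain k0 where k0: "\<And>k. max_norm k > k0 \<Longrightarrow> P l o\<^sub>L V k o\<^sub>L P m = 0"
      using P_V_P[OF l(1) m] by blast
    have "norm (T o\<^sub>L V k o\<^sub>L P m) < e" if "max_norm k > k0" for k
    proof -
      have "T o\<^sub>L V k o\<^sub>L P m = (T o\<^sub>L co_proj P l o\<^sub>L V k o\<^sub>L P m) + (T o\<^sub>L (P l o\<^sub>L V k o\<^sub>L P m))"
        by (rule blinfun_eqI) (simp add: co_proj_def blinfun.bilinear_simps)
      also have "\<dots> = (T o\<^sub>L co_proj P l o\<^sub>L V k) o\<^sub>L P m" using k0[OF that] by simp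
      also have "norm \<dots> \<le> norm (T o\<^sub>L co_proj P l o\<^sub>L V k) * norm (P m)"
        by (rule norm_blinfun_compose)
      also have "\<dots> \<le> norm (T o\<^sub>L co_proj P l o\<^sub>L V k)"
        by (intro mult_left_le norm_P_le norm_ge_zero)
      also have "\<dots> \<le> norm (T o\<^sub>L co_proj P l)" by (rule norm_compose_V_le)
      finally show ?thesis using l(2) by simp
    qed
    then show "\<exists>k0. \<forall>n. max_norm (h n) > k0 \<longrightarrow> norm (T o\<^sub>L V (h n) o\<^sub>L P m) < e" by blast
  qed
  show "(\<lambda>n. norm (P m o\<^sub>L V (h n) o\<^sub>L T)) \<longlonglongrightarrow> 0"
  proof (rule small)
    fix e :: real assume "e > 0"
    then obtain l where l: "l \<ge> 1" "norm (co_proj P l o\<^sub>L T) < e"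
      using large[of "\<lambda>n. co_proj P n o\<^sub>L T"] T unfolding P_compact_ops_def by blast
    obtain k0 where k0: "\<And>k. max_norm k > k0 \<Longrightarrow> P m o\<^sub>L V k o\<^sub>L P l = 0"
      using P_V_P[OF m l(1)] by blast
    have "norm (P m o\<^sub>L V k o\<^sub>L T) < e" if "max_norm k > k0" for k
    proof -
      have "P m o\<^sub>L V k o\<^sub>L T = (P m o\<^sub>L (V k o\<^sub>L (co_proj P l o\<^sub>L T))) + ((P m o\<^sub>L V k o\<^sub>L P l) o\<^sub>L T)"
        by (rule blinfun_eqI) (simp add: co_proj_def blinfun.bilinear_simps)
      also have "\<dots> = P m o\<^sub>L (V k o\<^sub>L (co_proj P l o\<^sub>L T))" using k0[OF that] by simp
      also have "norm \<dots> \<le> norm (P m) * norm (V k o\<^sub>L (co_proj P l o\<^sub>L T))"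
        by (rule norm_blinfun_compose)
      also have "\<dots> \<le> norm (V k o\<^sub>L (co_proj P l o\<^sub>L T))"
        by (intro mult_left_le_one_le norm_P_le norm_ge_zero)
      also have "\<dots> \<le> norm (co_proj P l o\<^sub>L T)" by (rule norm_compose_V_le)
      finally show ?thesis using l(2) by simp
    qed
    then show "\<exists>k0. \<forall>n. max_norm (h n) > k0 \<longrightarrow> norm (P m o\<^sub>L V (h n) o\<^sub>L T) < e" by blast
  qed
qed

text \<open>
  Write \<open>A\<^sub>n\<close> and \<open>B\<^sub>n\<close> for the shifted copies of \<open>A\<close> and of its regularizer \<open>B\<close>. On
  the range of \<open>P\<^sub>m\<close> the perturbation \<open>B\<^sub>n A\<^sub>n - I\<close> fades out, and \<open>A\<^sub>n\<close> approaches \<open>L\<close> there.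
\<close>

lemma limit_op_lower_bound_P:
  assumes BA: "B o\<^sub>L A = id_blinfun + T" and T: "T \<in> P_compact_ops smul P"
    and h: "filterlim (\<lambda>n. max_norm (h n)) at_top sequentially"
    and conv: "P_converges smul P (\<lambda>n. V (- h n) o\<^sub>L A o\<^sub>L V (h n)) L"
    and m: "m \<ge> 1"
  shows "norm (P m x) \<le> norm B * norm (L (P m x))"
proof (rule LIMSEQ_le_const)
  define D where "D n = ((V (- h n) o\<^sub>L A o\<^sub>L V (h n)) - L) o\<^sub>L P m" for n
  define E where "E n = T o\<^sub>L V (h n) o\<^sub>L P m" for n
  have "(\<lambda>n. norm (D n)) \<longlonglongrightarrow> 0"
    using conv P_in_P_compact_ops[of m] by (simp add: P_converges_def D_def)
  moreover have "(\<lambda>n. norm (E n)) \<longlonglongrightarrow> 0"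
    unfolding E_def using T m h by (rule P_compact_shift_tendsto_0)
  ultimately have "(\<lambda>n. norm B * (norm (L (P m x)) + norm (D n) * norm x) + norm (E n) * norm x)
      \<longlonglongrightarrow> norm B * (norm (L (P m x)) + 0 * norm x) + 0 * norm x"
    by (intro tendsto_intros)
  then show "(\<lambda>n. norm B * (norm (L (P m x)) + norm (D n) * norm x) + norm (E n) * norm x)
      \<longlonglongrightarrow> norm B * norm (L (P m x))" by simp
  have "norm (P m x) \<le> norm B * (norm (L (P m x)) + norm (D n) * norm x) + norm (E n) * norm x" for n
  proof -
    define y where "y = V (h n) (P m x)"
    have VV: "V (- h n) (A y) = L (P m x) + D n x"
      by (simp add: D_def y_def blinfun.diff_left)
    have "norm (A y) = norm (L (P m x) + D n x)"
      using VV V_isometry by metis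
    also have "\<dots> \<le> norm (L (P m x)) + norm (D n) * norm x"
      by (intro order_trans[OF norm_triangle_ineq] add_left_mono norm_blinfun)
    finally have Ay: "norm (A y) \<le> norm (L (P m x)) + norm (D n) * norm x" .
    have "B (A y) = y + E n x"
      using BA by (metis (no_types, lifting) E_def y_def blinfun.add_left
          blinfun_apply_blinfun_compose blinfun_apply_id_blinfun id_apply)
    then have y: "y = B (A y) - E n x" by simp
    have "norm (P m x) = norm y" by (simp add: y_def V_isometry)
    also have "\<dots> \<le> norm (B (A y)) + norm (E n x)"
      by (subst y) (rule norm_triangle_ineq4)
    also have "\<dots> \<le> norm B * norm (A y) + norm (E n) * norm x"
      by (intro add_mono norm_blinfun)
    also have "\<dots> \<le> norm B * (norm (L (P m x)) + norm (D n) * norm x) + norm (E n) * norm x"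
      using Ay by (intro add_right_mono mult_left_mono) auto
    finally show ?thesis .
  qed
  then show "\<exists>N. \<forall>n\<ge>N. norm (P m x) \<le>
      norm B * (norm (L (P m x)) + norm (D n) * norm x) + norm (E n) * norm x" by blast
qed

text \<open>The same argument for the adjoints, with \<open>A\<^sub>n B\<^sub>n\<close> and truncation from the left.\<close>

lemma limit_op_dual_lower_bound_P:
  fixes f :: "'a \<Rightarrow>\<^sub>L 'k"
  assumes AB: "A o\<^sub>L B = id_blinfun + T" and T: "T \<in> P_compact_ops smul P"
    and h: "filterlim (\<lambda>n. max_norm (h n)) at_top sequentially"
    and conv: "P_converges smul P (\<lambda>n. V (- h n) o\<^sub>L A o\<^sub>L V (h n)) L"
    and m: "m \<ge> 1"
  shows "norm (f o\<^sub>L P m) \<le> norm B * norm (f o\<^sub>L P m o\<^sub>L L)"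
proof (rule LIMSEQ_le_const)
  define D where "D n = P m o\<^sub>L ((V (- h n) o\<^sub>L A o\<^sub>L V (h n)) - L)" for n
  define E where "E n = P m o\<^sub>L V (- h n) o\<^sub>L T" for n
  have "(\<lambda>n. norm (D n)) \<longlonglongrightarrow> 0"
    using conv P_in_P_compact_ops[of m] by (simp add: P_converges_def D_def)
  moreover have "(\<lambda>n. norm (E n)) \<longlonglongrightarrow> 0"
    unfolding E_def using T m by (rule P_compact_shift_tendsto_0) (simp add: max_norm_uminus h)
  ultimately have "(\<lambda>n. (norm (f o\<^sub>L P m o\<^sub>L L) + norm f * norm (D n)) * norm B + norm f * norm (E n))
      \<longlonglongrightarrow> (norm (f o\<^sub>L P m o\<^sub>L L) + norm f * 0) * norm B + norm f * 0"
    by (intro tendsto_intros)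
  then show "(\<lambda>n. (norm (f o\<^sub>L P m o\<^sub>L L) + norm f * norm (D n)) * norm B + norm f * norm (E n))
      \<longlonglongrightarrow> norm B * norm (f o\<^sub>L P m o\<^sub>L L)" by (simp add: mult.commute)
  have "norm (f o\<^sub>L P m) \<le> (norm (f o\<^sub>L P m o\<^sub>L L) + norm f * norm (D n)) * norm B + norm f * norm (E n)" for n
  proof -
    define u where "u = f o\<^sub>L P m o\<^sub>L V (- h n)"
    have V_id: "V (h n) (V (- h n) x) = x" "V (- h n) (V (h n) x) = x" for x
      using V_inverse[of "h n"] V_inverse[of "- h n"]
      by (metis blinfun_apply_blinfun_compose blinfun_apply_id_blinfun id_apply minus_minus)+
    have uA: "u o\<^sub>L A = ((f o\<^sub>L P m o\<^sub>L L) + (f o\<^sub>L D n)) o\<^sub>L V (- h n)"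
      by (rule blinfun_eqI) (simp add: u_def D_def blinfun.bilinear_simps V_id)
    have "norm (u o\<^sub>L A) \<le> norm ((f o\<^sub>L P m o\<^sub>L L) + (f o\<^sub>L D n)) * norm (V (- h n))"
      unfolding uA by (rule norm_blinfun_compose)
    also have "\<dots> \<le> norm ((f o\<^sub>L P m o\<^sub>L L) + (f o\<^sub>L D n))"
      by (intro mult_left_le norm_V_le norm_ge_zero)
    also have "\<dots> \<le> norm (f o\<^sub>L P m o\<^sub>L L) + norm f * norm (D n)"
      by (intro order_trans[OF norm_triangle_ineq] add_left_mono norm_blinfun_compose)
    finally have uA_le: "norm (u o\<^sub>L A) \<le> norm (f o\<^sub>L P m o\<^sub>L L) + norm f * norm (D n)" .
    have AB_x: "A (B x) = x + T x" for x
      using arg_cong[OF AB, of "\<lambda>S. blinfun_apply S x"] by (simp add: blinfun.add_left)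
    have fP: "f o\<^sub>L P m = ((u o\<^sub>L A o\<^sub>L B) - (f o\<^sub>L E n)) o\<^sub>L V (h n)"
      by (rule blinfun_eqI) (simp add: u_def E_def AB_x blinfun.bilinear_simps V_id)
    have "norm (f o\<^sub>L P m) \<le> norm ((u o\<^sub>L A o\<^sub>L B) - (f o\<^sub>L E n)) * norm (V (h n))"
      by (subst fP) (rule norm_blinfun_compose)
    also have "\<dots> \<le> norm ((u o\<^sub>L A o\<^sub>L B) - (f o\<^sub>L E n))"
      by (intro mult_left_le norm_V_le norm_ge_zero)
    also have "\<dots> \<le> norm (u o\<^sub>L A) * norm B + norm f * norm (E n)"
      by (intro order_trans[OF norm_triangle_ineq4] add_mono norm_blinfun_compose)
    also have "\<dots> \<le> (norm (f o\<^sub>L P m o\<^sub>L L) + norm f * norm (D n)) * norm B + norm f * norm (E n)"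
      using uA_le by (intro add_right_mono mult_right_mono) auto
    finally show ?thesis .
  qed
  then show "\<exists>N. \<forall>n\<ge>N. norm (f o\<^sub>L P m) \<le>
      (norm (f o\<^sub>L P m o\<^sub>L L) + norm f * norm (D n)) * norm B + norm f * norm (E n)" by blast
qed

text \<open>
  Perfectness is what allows the truncations to be removed: \<open>P\<^sub>m x\<close> converges to \<open>x\<close>, and the
  functionals \<open>f \<circ> P\<^sub>m\<close> converge in norm to \<open>f\<close>.
\<close>

lemma limit_op_bounds:
  assumes perf: "perfect smul P"
    and AB: "A o\<^sub>L B = id_blinfun + T1" and T1: "T1 \<in> P_compact_ops smul P"
    and BA: "B o\<^sub>L A = id_blinfun + T2" and T2: "T2 \<in> P_compact_ops smul P"
    and L: "L \<in> limit_ops smul P V A"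
  shows "norm x \<le> norm B * norm (L x)"
    and "f \<in> dual_space smul \<Longrightarrow> norm f \<le> norm B * norm (f o\<^sub>L L)"
proof -
  obtain h where h: "filterlim (\<lambda>n. max_norm (h n)) at_top sequentially"
    and conv: "P_converges smul P (\<lambda>n. V (- h n) o\<^sub>L A o\<^sub>L V (h n)) L"
    using L by (auto simp: limit_ops_def)
  show "norm x \<le> norm B * norm (L x)"
  proof (rule LIMSEQ_le)
    have "(\<lambda>n. P n x) \<longlonglongrightarrow> x" using perf by (simp add: perfect_def)
    then show "(\<lambda>n. norm (P n x)) \<longlonglongrightarrow> norm x"
      "(\<lambda>n. norm B * norm (L (P n x))) \<longlonglongrightarrow> norm B * norm (L x)"
      by (intro tendsto_intros; assumption)+
    show "\<exists>N. \<forall>n\<ge>N. norm (P n x) \<le> norm B * norm (L (P n x))"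
      using limit_op_lower_bound_P[OF BA T2 h conv] by blast
  qed
  show "norm f \<le> norm B * norm (f o\<^sub>L L)" if f: "f \<in> dual_space smul"
  proof (rule LIMSEQ_le)
    have "(\<lambda>n. f o\<^sub>L P n) \<longlonglongrightarrow> f" using perf f by (simp add: perfect_def dual_op_def)
    then show "(\<lambda>n. norm (f o\<^sub>L P n)) \<longlonglongrightarrow> norm f"
      "(\<lambda>n. norm B * norm (f o\<^sub>L P n o\<^sub>L L)) \<longlonglongrightarrow> norm B * norm (f o\<^sub>L L)"
      by (intro tendsto_intros bounded_bilinear.tendsto[OF bounded_bilinear_blinfun_compose]; assumption)+
    show "\<exists>N. \<forall>n\<ge>N. norm (f o\<^sub>L P n) \<le> norm B * norm (f o\<^sub>L P n o\<^sub>L L)"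
      using limit_op_dual_lower_bound_P[OF AB T1 h conv] by blast
  qed
qed

theorem invertible_at_infinity_imp_uniformly_invertible:
  assumes perf: "perfect smul P" and inv: "invertible_at_infinity smul P A"
  shows "uniformly_invertible (limit_ops smul P V A)"
proof -
  obtain B T1 T2 where
    AB: "A o\<^sub>L B = id_blinfun + T1" "T1 \<in> P_compact_ops smul P" and
    BA: "B o\<^sub>L A = id_blinfun + T2" "T2 \<in> P_compact_ops smul P"
    using inv by (auto simp: invertible_at_infinity_def)
  note bounds = limit_op_bounds[OF perf AB BA]
  have bij: "bij (blinfun_apply L)" if "L \<in> limit_ops smul P V A" for L
    using that bounds[OF that] by (intro bij_if_bounded_below) (auto simp: limit_ops_def)
  have "bounded_linear (inv L) \<and> onorm (inv L) \<le> norm B" if L: "L \<in> limit_ops smul P V A" for L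
  proof -
    have inj: "inj (blinfun_apply L)" and L_inv: "L (inv (blinfun_apply L) y) = y" for y
      using bij[OF L] by (auto simp: bij_is_inj bij_is_surj surj_f_inv_f)
    have inv_bound: "norm (inv L y) \<le> norm B * norm y" for y
      using bounds(1)[OF L, of "inv L y"] by (simp add: L_inv)
    have "bounded_linear (inv L)"
    proof (rule bounded_linear_intro)
      show "inv L (x + y) = inv L x + inv L y" for x y
        by (rule injD[OF inj]) (simp add: L_inv blinfun.add_right)
      show "inv L (r *\<^sub>R x) = r *\<^sub>R inv L x" for r x
        by (rule injD[OF inj]) (simp add: L_inv blinfun.scaleR_right)
      show "norm (inv L y) \<le> norm y * norm B" for y
        using inv_bound[of y] by (simp add: mult.commute)
    qed
    moreover have "onorm (inv L) \<le> norm B"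
      by (rule onorm_bound) (simp_all add: inv_bound)
    ultimately show ?thesis by blast
  qed
  with bij show ?thesis by (auto simp: uniformly_invertible_def)
qed

end

section \<open>Fredholmness, invertibility at infinity and limit operators\<close>

theorem lemma5p13:
  fixes smul :: "'k::real_or_complex \<Rightarrow> 'a::banach \<Rightarrow> 'a"
    and P :: "nat \<Rightarrow> 'a \<Rightarrow>\<^sub>L 'a"
    and V :: "int ^ 'N::finite \<Rightarrow> 'a \<Rightarrow>\<^sub>L 'a"
    and A :: "'a \<Rightarrow>\<^sub>L 'a"
  assumes "shift_setting smul P V"
    and "perfect smul P"
    and "A \<in> bounded_ops smul"
  shows "(fredholm smul A \<longrightarrow> invertible_at_infinity smul P A) \<and>
         (invertible_at_infinity smul P A \<longrightarrow> uniformly_invertible (limit_ops smul P V A))"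
proof -
  interpret shift_setting smul P V by fact
  show ?thesis
    using fredholm_imp_invertible_at_infinity[OF assms(2,3)]
      invertible_at_infinity_imp_uniformly_invertible[OF assms(2)]
    by blast
qed

end
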